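(* Let $V$ be the subgroup of $\mathcal{L}_n$ with triple $(s,V_0,v)$. Then $V$ is closed in the profinite topology of $\mathcal{L}_n$ if and only if either $s>0$, or $s=0$ and $V=V_0$ is closed as a subset of $\mathbb{F}_p[[\hat{\mathbb{Z}}]]^n$ (that is, $V_0$ is equal to the intersection of its closure in $\mathbb{F}_p[[\hat{\mathbb{Z}}]]^n$ with $\mathcal{A}_n$).
   Context: $p$ is a fixed prime, $n\ge 1$, $R=\mathbb{F}_p[x,x^{-1}]=\mathbb{F}_p[\mathbb{Z}]$. $\mathcal{A}_n=\bigoplus_{\mathbb{Z}}(\mathbb{Z}/p\mathbb{Z})^n$ is identified with the additive group of $R^n$, so that the shift by one on $\mathcal{A}_n$ is multiplication by $x$. $\mathcal{L}_n=(\mathbb{Z}/p\mathbb{Z})^n\wr\mathbb{Z}=\mathcal{A}_n\rtimes\mathbb{Z}$, with elements written $(v,s)$ and multiplication $(v,s)(w,t)=(v+x^sw,s+t)$; $\mathcal{A}_n$ is identified with $\{(v,0)\}$. The triple $(s,V_0,v)$ of a subgroup $V\le\mathcal{L}_n$: $s\ge 0$ is the integer such that $s\mathbb{Z}$ is the image of $V$ under the projection to $\mathbb{Z}$, $V_0=V\cap\mathcal{A}_n$ (it satisfies $x^sV_0=V_0$), and $v\in\mathcal{A}_n$ is any element with $(v,s)\in V$ (well defined modulo $V_0$; for $s=0$ one takes $v=0$). $\mathbb{F}_p[[\hat{\mathbb{Z}}]]=\varprojlim_m\mathbb{F}_p[\mathbb{Z}/m\mathbb{Z}]$ (over $m$ ordered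 by divisibility) with the projective limit topology; $R=\mathbb{F}_p[\mathbb{Z}]$ embeds in it naturally, and so $\mathcal{A}_n=R^n\subset\mathbb{F}_p[[\hat{\mathbb{Z}}]]^n$. A subgroup of a group $G$ is closed in the profinite topology if it is closed for the topology on $G$ with basis of neighbourhoods of $1$ the normal subgroups of finite index. *)

theory Defs
  imports
    "HOL-Analysis.Analysis"
    "HOL-Algebra.Coset"
    "HOL-Algebra.Elementary_Groups"
    "HOL-Library.Poly_Mapping"
    "Berlekamp_Zassenhaus.Finite_Field"
begin

text \<open>
  The prime is \<open>p = CARD('p)\<close> with \<open>'p :: prime_card\<close>, so that \<open>'p mod_ring\<close> is the field
  of integers modulo \<open>p\<close>; the rank is \<open>n = CARD('n)\<close>.  The multiplication of
  \<open>int \<Rightarrow>\<^sub>0 'p mod_ring\<close> is convolution, hence this type is the group ring of the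
  integers, i.e. the ring of Laurent polynomials.
\<close>

type_synonym 'p laurent = "int \<Rightarrow>\<^sub>0 'p mod_ring"
type_synonym ('p, 'n) lamps = "('p laurent) ^ 'n"

definition x_pow :: "int \<Rightarrow> ('p :: prime_card) laurent" where
  "x_pow s = Poly_Mapping.single s 1"

definition lamplighter ::
  "(('p :: prime_card, 'n :: finite) lamps \<times> int) monoid" where
  "lamplighter =
    \<lparr> carrier = UNIV,
      mult = (\<lambda>(v, s) (w, t). (v + x_pow s *s w, s + t)),
      one = (0, 0) \<rparr>"

lemma x_pow_add: "x_pow (s + t) = x_pow s * x_pow t"
  by (simp add: x_pow_def mult_single)

lemma x_pow_0: "x_pow 0 = 1"
  by (simp add: x_pow_def)

lemma group_lamplighter: "group (lamplighter :: (('p :: prime_card, 'n :: finite) lamps \<times> int) monoid)"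
proof (rule groupI)
  fix g :: "('p, 'n) lamps \<times> int"
  obtain v s where g: "g = (v, s)" by (cases g)
  have "x_pow (- s) *s (- v) + x_pow (- s) *s v = 0"
    by (simp add: vec_eq_iff)
  then have "(x_pow (- s) *s (- v), - s) \<otimes>\<^bsub>lamplighter\<^esub> g = \<one>\<^bsub>lamplighter\<^esub>"
    by (simp add: lamplighter_def g)
  moreover have "(x_pow (- s) *s (- v), - s) \<in> carrier lamplighter"
    by (simp add: lamplighter_def)
  ultimately show "\<exists>h\<in>carrier lamplighter. h \<otimes>\<^bsub>lamplighter\<^esub> g = \<one>\<^bsub>lamplighter\<^esub>"
    by blast
qed (auto simp: lamplighter_def x_pow_0 x_pow_add vec_eq_iff algebra_simps)

definition base_incl :: "('p :: prime_card, 'n :: finite) lamps \<Rightarrow> ('p, 'n) lamps \<times> int" where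
  "base_incl w = (w, 0)"

definition is_triple ::
  "(('p :: prime_card, 'n :: finite) lamps \<times> int) set \<Rightarrow>
    nat \<Rightarrow> ('p, 'n) lamps set \<Rightarrow> ('p, 'n) lamps \<Rightarrow> bool" where
  "is_triple V s V0 v \<longleftrightarrow>
    snd ` V = range (\<lambda>k. int s * k) \<and>
    V0 = {w. base_incl w \<in> V} \<and>
    (v, int s) \<in> V \<and>
    (s = 0 \<longrightarrow> v = 0)"

definition profinite_topology :: "('g, 'm) monoid_scheme \<Rightarrow> 'g topology" where
  "profinite_topology G = topology (\<lambda>U. U \<subseteq> carrier G \<and>
    (\<forall>g\<in>U. \<exists>N. N \<lhd> G \<and> finite (rcosets\<^bsub>G\<^esub> N) \<and> g <#\<^bsub>G\<^esub> N \<subseteq> U))"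

lemma (in group) finite_rcosets_Int:
  assumes "subgroup M G" "subgroup N G" "finite (rcosets M)" "finite (rcosets N)"
  shows "finite (rcosets (M \<inter> N))"
proof (rule finite_subset)
  show "rcosets (M \<inter> N) \<subseteq> (\<lambda>(A, B). A \<inter> B) ` ((rcosets M) \<times> (rcosets N))"
  proof
    fix C assume "C \<in> rcosets (M \<inter> N)"
    then obtain a where a: "a \<in> carrier G" "C = (M \<inter> N) #> a"
      by (auto simp: RCOSETS_def)
    have sub: "M \<subseteq> carrier G" "N \<subseteq> carrier G"
      using assms subgroup.subset by auto
    have "C = (M #> a) \<inter> (N #> a)"
    proof (intro equalityI subsetI)
      fix x assume "x \<in> (M #> a) \<inter> (N #> a)"
      then obtain m n where "m \<in> M" "n \<in> N" "x = m \<otimes> a" "x = n \<otimes> a"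
        by (auto simp: r_coset_def)
      moreover from this have "m = n"
        using a(1) sub right_cancel by blast
      ultimately show "x \<in> C" by (auto simp: a r_coset_def)
    qed (auto simp: a r_coset_def)
    then show "C \<in> (\<lambda>(A, B). A \<inter> B) ` ((rcosets M) \<times> (rcosets N))"
      using a(1) by (auto simp: RCOSETS_def)
  qed
qed (use assms in simp)

lemma (in group) openin_profinite_topology:
  "openin (profinite_topology G) U \<longleftrightarrow> U \<subseteq> carrier G \<and>
    (\<forall>g\<in>U. \<exists>N. N \<lhd> G \<and> finite (rcosets N) \<and> g <# N \<subseteq> U)"
proof -
  define P where "P = (\<lambda>U. U \<subseteq> carrier G \<and>
    (\<forall>g\<in>U. \<exists>N. N \<lhd> G \<and> finite (rcosets N) \<and> g <# N \<subseteq> U))"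
  have "P (S \<inter> T)" if "P S" "P T" for S T
    unfolding P_def
  proof (intro conjI ballI)
    fix g assume g: "g \<in> S \<inter> T"
    obtain M where M: "M \<lhd> G" "finite (rcosets M)" "g <# M \<subseteq> S"
      using \<open>P S\<close> g unfolding P_def by blast
    obtain N where N: "N \<lhd> G" "finite (rcosets N)" "g <# N \<subseteq> T"
      using \<open>P T\<close> g unfolding P_def by blast
    have "finite (rcosets (M \<inter> N))"
      using M N by (intro finite_rcosets_Int normal_imp_subgroup)
    moreover have "M \<inter> N \<lhd> G"
      using M N by (intro normal_subgroup_intersect)
    moreover have "g <# (M \<inter> N) \<subseteq> S \<inter> T"
      using M N by (auto simp: l_coset_def)
    ultimately show "\<exists>K. K \<lhd> G \<and> finite (rcosets K) \<and> g <# K \<subseteq> S \<inter> T"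
      by blast
  qed (use that in \<open>auto simp: P_def\<close>)
  moreover have "P (\<Union>K)" if "\<forall>S\<in>K. P S" for K
    unfolding P_def
  proof (intro conjI ballI)
    fix g assume "g \<in> \<Union>K"
    then obtain S where S: "S \<in> K" "g \<in> S" by blast
    moreover from this have "P S" using that by blast
    ultimately obtain N where "N \<lhd> G" "finite (rcosets N)" "g <# N \<subseteq> S"
      unfolding P_def by blast
    with S show "\<exists>N. N \<lhd> G \<and> finite (rcosets N) \<and> g <# N \<subseteq> \<Union>K" by blast
  qed (use that in \<open>auto simp: P_def\<close>)
  ultimately have "istopology P"
    by (simp add: istopology_def)
  then have "openin (profinite_topology G) = P"
    unfolding profinite_topology_def P_def by (rule topology_inverse')
  then show ?thesis by (simp add: P_def)
qed

text \<open>
  Only the topological space underlying the completed group algebra is needed: it is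
  constructed as the inverse limit of the discrete spaces underlying the group algebras of
  the groups of integers modulo \<open>m\<close>, for \<open>m \<ge> 1\<close>.  Elements of the latter are functions on
  \<open>carrier (integer_mod_group m) = {0..<int m}\<close>, made extensional so that equality of
  functions is equality in the group algebra.
\<close>

definition cyclic_algebra :: "nat \<Rightarrow> (int \<Rightarrow> ('p :: prime_card) mod_ring) set" where
  "cyclic_algebra m = carrier (integer_mod_group m) \<rightarrow>\<^sub>E UNIV"

text \<open>
  The linear extension of the reduction map from the integers modulo \<open>l\<close> to the integers
  modulo \<open>m\<close>, where \<open>m\<close> divides \<open>l\<close>.
\<close>

definition cyclic_algebra_map ::
  "nat \<Rightarrow> nat \<Rightarrow> (int \<Rightarrow> ('p :: prime_card) mod_ring) \<Rightarrow> int \<Rightarrow> 'p mod_ring" where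
  "cyclic_algebra_map l m f =
    (\<lambda>a \<in> carrier (integer_mod_group m).
      \<Sum>b \<in> {b \<in> carrier (integer_mod_group l). b mod int m = a}. f b)"

definition completed_algebra :: "(nat \<Rightarrow> int \<Rightarrow> ('p :: prime_card) mod_ring) set" where
  "completed_algebra =
    {f \<in> (\<Pi>\<^sub>E m\<in>{1..}. cyclic_algebra m).
      \<forall>l\<ge>1. \<forall>m\<ge>1. m dvd l \<longrightarrow> cyclic_algebra_map l m (f l) = f m}"

definition completed_topology :: "(nat \<Rightarrow> int \<Rightarrow> ('p :: prime_card) mod_ring) topology" where
  "completed_topology =
    subtopology (product_topology (\<lambda>m. discrete_topology (cyclic_algebra m)) {1..})
      completed_algebra"

definition completed_topology_power ::
  "('n :: finite \<Rightarrow> nat \<Rightarrow> int \<Rightarrow> ('p :: prime_card) mod_ring) topology" where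
  "completed_topology_power = product_topology (\<lambda>_. completed_topology) UNIV"

definition laurent_embed :: "('p :: prime_card) laurent \<Rightarrow> nat \<Rightarrow> int \<Rightarrow> 'p mod_ring" where
  "laurent_embed r =
    (\<lambda>m \<in> {1..}. \<lambda>a \<in> carrier (integer_mod_group m).
      \<Sum>k \<in> {k \<in> Poly_Mapping.keys r. k mod int m = a}. Poly_Mapping.lookup r k)"

definition lamps_embed ::
  "('p :: prime_card, 'n :: finite) lamps \<Rightarrow> 'n \<Rightarrow> nat \<Rightarrow> int \<Rightarrow> 'p mod_ring" where
  "lamps_embed w = (\<lambda>i. laurent_embed (w $ i))"

lemma topspace_completed_topology: "topspace completed_topology = completed_algebra"
  by (auto simp: completed_topology_def completed_algebra_def)

lemma laurent_embed_in: "laurent_embed r \<in> completed_algebra"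
proof -
  have "cyclic_algebra_map l m (laurent_embed r l) = laurent_embed r m"
    if lm: "l \<ge> 1" "m \<ge> 1" "m dvd l" for l m
  proof
    fix a :: int
    have fin: "finite {b \<in> {0..<int l}. b mod int m = a}"
      by (rule finite_subset[of _ "{0..<int l}"]) auto
    have modmod: "k mod int l mod int m = k mod int m" for k
      using lm by (simp add: mod_mod_cancel)
    have "(\<Sum>b \<in> {b \<in> {0..<int l}. b mod int m = a}.
        \<Sum>k \<in> {k \<in> Poly_Mapping.keys r. k mod int l = b}. Poly_Mapping.lookup r k)
      = (\<Sum>k \<in> (\<Union>b \<in> {b \<in> {0..<int l}. b mod int m = a}.
          {k \<in> Poly_Mapping.keys r. k mod int l = b}). Poly_Mapping.lookup r k)"
      by (rule sum.UNION_disjoint[OF fin, symmetric]) auto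
    also have "(\<Union>b \<in> {b \<in> {0..<int l}. b mod int m = a}.
          {k \<in> Poly_Mapping.keys r. k mod int l = b}) = {k \<in> Poly_Mapping.keys r. k mod int m = a}"
      using lm(1) modmod by (auto intro!: pos_mod_bound pos_mod_sign)
    finally have sums: "(\<Sum>b \<in> {b \<in> {0..<int l}. b mod int m = a}.
        \<Sum>k \<in> {k \<in> Poly_Mapping.keys r. k mod int l = b}. Poly_Mapping.lookup r k)
      = (\<Sum>k \<in> {k \<in> Poly_Mapping.keys r. k mod int m = a}. Poly_Mapping.lookup r k)" .
    have carr: "carrier (integer_mod_group l) = {0..<int l}"
      "carrier (integer_mod_group m) = {0..<int m}" "l \<in> {1..}" "m \<in> {1..}"
      using lm by (simp_all add: carrier_integer_mod_group)
    have "(\<Sum>b \<in> {b \<in> {0..<int l}. b mod int m = a}. laurent_embed r l b)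
      = (\<Sum>b \<in> {b \<in> {0..<int l}. b mod int m = a}.
        \<Sum>k \<in> {k \<in> Poly_Mapping.keys r. k mod int l = b}. Poly_Mapping.lookup r k)"
      by (rule sum.cong[OF refl]) (simp only: laurent_embed_def carr restrict_apply mem_Collect_eq if_True)
    moreover have "laurent_embed r m a = (if a \<in> {0..<int m}
        then \<Sum>k \<in> {k \<in> Poly_Mapping.keys r. k mod int m = a}. Poly_Mapping.lookup r k
        else undefined)"
      by (simp only: laurent_embed_def carr restrict_apply if_True)
    ultimately show "cyclic_algebra_map l m (laurent_embed r l) a = laurent_embed r m a"
      by (simp only: cyclic_algebra_map_def carr restrict_apply sums)
  qed
  then show ?thesis
    by (auto simp: completed_algebra_def cyclic_algebra_def laurent_embed_def)
qed

lemma inj_laurent_embed: "inj laurent_embed"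
proof (rule injI)
  fix q r :: "('p :: prime_card) laurent"
  assume eq: "laurent_embed q = laurent_embed r"
  show "q = r"
  proof (rule poly_mapping_eqI)
    fix j
    define S where "S = insert j (Poly_Mapping.keys q \<union> Poly_Mapping.keys r)"
    have "finite S" by (simp add: S_def)
    define m where "m = Suc (nat (2 * (\<Sum>k\<in>S. \<bar>k\<bar>)))"
    have le: "\<bar>k\<bar> \<le> (\<Sum>k\<in>S. \<bar>k\<bar>)" if "k \<in> S" for k
      using member_le_sum[of k S abs] that \<open>finite S\<close> by simp
    have uniq: "k = j" if "k \<in> S" "k mod int m = j mod int m" for k
    proof -
      have "int m dvd k - j" using that by (simp add: mod_eq_dvd_iff)
      moreover have "\<bar>k - j\<bar> < int m"
        using le[OF that(1)] le[of j] by (simp add: m_def S_def)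
      ultimately show ?thesis using dvd_imp_le_int[of "k - j" "int m"] by fastforce
    qed
    have val: "laurent_embed u m (j mod int m) = Poly_Mapping.lookup u j"
      if "Poly_Mapping.keys u \<subseteq> S" for u :: "'p laurent"
    proof -
      have "{k \<in> Poly_Mapping.keys u. k mod int m = j mod int m}
          = (if j \<in> Poly_Mapping.keys u then {j} else {})"
        using uniq that by auto
      moreover have "m \<ge> 1" by (simp add: m_def)
      then have "m \<in> {1..}" "j mod int m \<in> carrier (integer_mod_group m)"
        by (simp_all add: carrier_integer_mod_group)
      ultimately show ?thesis
        by (simp add: laurent_embed_def in_keys_iff)
    qed
    show "Poly_Mapping.lookup q j = Poly_Mapping.lookup r j"
    proof -
      have "Poly_Mapping.keys q \<subseteq> S" "Poly_Mapping.keys r \<subseteq> S"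
        by (auto simp: S_def)
      from val[OF this(1)] val[OF this(2)] eq show ?thesis by simp
    qed
  qed
qed

end

theory Submission
  imports Defs
begin

text \<open>
  A normal subgroup of finite index contains some \<open>(0, m)\<close>, hence, by commutators,
  \<open>(x^m - 1) R^n\<close>; conversely \<open>(x^a - 1) R^n\<close> together with the multiples of \<open>b\<close> in the second
  component is such a subgroup whenever \<open>a\<close> divides \<open>b\<close>.  As \<open>(x^m - 1) R^n\<close> is also the kernel
  of the reduction to the group algebra of the integers modulo \<open>m\<close>, both topologies induce the
  same one on the base group, which settles \<open>s = 0\<close>.

  For \<open>s > 0\<close>, multiplication by an element of \<open>V\<close> reduces the separation of an element from \<open>V\<close>
  to that of some \<open>w\<close> in the base group from \<open>V0\<close>, a module over the Laurent polynomials in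
  \<open>y = x^s\<close>.  Over this ring \<open>R^n\<close> is finitely generated, so that \<open>w\<close> lies outside
  \<open>V0 + (y^m - 1) R^n\<close> for some \<open>m \<ge> 1\<close>.  In characteristic \<open>p\<close>, the \<open>m p\<close>-th power of an element
  of \<open>V\<close> over \<open>s\<close> has first component in \<open>(y^m - 1) R^n\<close>, and therefore the normal subgroup
  attached to \<open>a = s m\<close> and \<open>b = s m p\<close> separates \<open>w\<close> from all of \<open>V\<close>.
\<close>

subsection \<open>Laurent polynomials\<close>

lemma poly_mapping_single_induct:
  fixes r :: "'a \<Rightarrow>\<^sub>0 'b :: comm_monoid_add"
  assumes "\<And>k c. P (Poly_Mapping.single k c)" and "\<And>q r. P q \<Longrightarrow> P r \<Longrightarrow> P (q + r)"
  shows "P r"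
proof -
  have "P (\<Sum>k\<in>K. Poly_Mapping.single k (Poly_Mapping.lookup r k))" if "finite K" for K
    using that
  proof induction
    case empty
    show ?case using assms(1)[of undefined 0] by simp
  qed (use assms in simp)
  moreover have "(\<Sum>k\<in>Poly_Mapping.keys r. Poly_Mapping.single k (Poly_Mapping.lookup r k)) = r"
    by (rule poly_mapping_eqI)
      (auto simp: lookup_sum lookup_single when_def in_keys_iff)
  ultimately show ?thesis by (metis finite_keys)
qed

lemma lookup_single_mult:
  fixes r :: "int \<Rightarrow>\<^sub>0 'b :: semiring_0"
  shows "Poly_Mapping.lookup (Poly_Mapping.single j c * r) k = c * Poly_Mapping.lookup r (k - j)"
proof (induction r rule: poly_mapping_single_induct)
  case (1 i d)
  then show ?case by (auto simp: mult_single lookup_single when_def)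
next
  case (2 q r)
  then show ?case by (simp add: distrib_left lookup_add)
qed

lemma lookup_x_pow_mult: "Poly_Mapping.lookup (x_pow j * r) k = Poly_Mapping.lookup r (k - j)"
  by (simp add: x_pow_def lookup_single_mult)

lemma single_eq_scaled_x_pow: "Poly_Mapping.single k c = Poly_Mapping.single 0 c * x_pow k"
  by (simp add: x_pow_def mult_single)

lemma x_pow_power: "x_pow k ^ n = x_pow (int n * k)"
  by (induction n) (simp_all add: x_pow_0 distrib_right flip: x_pow_add)

lemma x_pow_minus_1_nonzero:
  assumes "m \<noteq> 0" shows "x_pow m - 1 \<noteq> (0 :: ('p :: prime_card) laurent)"
proof
  assume "x_pow m - 1 = (0 :: 'p laurent)"
  then have "Poly_Mapping.lookup (x_pow m - 1 :: 'p laurent) m = 0" by simp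
  then show False using assms by (simp add: x_pow_def lookup_minus lookup_one)
qed

lemma x_pow_minus_1_dvd:
  assumes "m dvd k"
  shows "x_pow m - 1 dvd (x_pow k - 1 :: ('p :: prime_card) laurent)"
proof -
  obtain q where k: "k = m * q" using assms by blast
  have nonneg: "x_pow m - 1 dvd (x_pow (m * int n) - 1 :: 'p laurent)" for n
    using power_diff_1_eq[of "x_pow m :: 'p laurent" n] by (simp add: x_pow_power mult.commute)
  show ?thesis
  proof (cases "q \<ge> 0")
    case True
    then show ?thesis using nonneg[of "nat q"] k by simp
  next
    case False
    \<comment> \<open>A negative quotient is reduced to a positive one by pulling out the unit
      \<open>-x^k\<close>, which leaves \<open>x^(-k) - 1\<close>.\<close>
    have "x_pow k - 1 = - x_pow k * (x_pow (m * int (nat (- q))) - 1 :: 'p laurent)"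
      using False by (simp add: k algebra_simps flip: x_pow_add) (simp add: x_pow_0)
    then show ?thesis using nonneg by (metis dvd_mult)
  qed
qed

lemma of_nat_card_laurent: "of_nat CARD('p) = (0 :: ('p :: prime_card) laurent)"
proof -
  have "of_nat CARD('p) = (0 :: 'p mod_ring)" by simp
  then show ?thesis by (metis single_of_nat single_zero)
qed

text \<open>The cofactor of \<open>y - 1\<close> is the sum of the powers \<open>y^i\<close> with
  \<open>i < p\<close>. As \<open>p = 0\<close> in the ring, it equals the sum of the
  \<open>y^i - 1\<close>, which is again divisible by \<open>y - 1\<close>.\<close>

lemma square_dvd_power_card_minus_1:
  fixes y :: "('p :: prime_card) laurent"
  shows "(y - 1)\<^sup>2 dvd y ^ CARD('p) - 1"
proof -
  have "y - 1 dvd (\<Sum>i<CARD('p). y ^ i - 1)"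
    by (rule dvd_sum) (metis dvd_triv_left power_diff_1_eq)
  then have "y - 1 dvd (\<Sum>i<CARD('p). y ^ i)"
    using of_nat_card_laurent[where ?'p = 'p] by (simp add: sum_subtractf)
  then show ?thesis
    by (simp add: power_diff_1_eq power2_eq_square mult_dvd_mono)
qed

text \<open>With \<open>y = x^s\<close>, this sum multiplies the first component when an element
  over \<open>s\<close> is raised to the power \<open>m * p\<close>. Times \<open>y - 1\<close> it
  becomes \<open>(y^m)^p - 1\<close>, which contains the factor \<open>y^m - 1\<close> twice;
  cancelling \<open>y - 1\<close> uses up only one of them.\<close>

lemma power_minus_1_dvd_sum_powers:
  fixes y :: "('p :: prime_card) laurent"
  assumes "y \<noteq> 1"
  shows "y ^ m - 1 dvd (\<Sum>i<m * CARD('p). y ^ i)"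
proof -
  obtain r where r: "(y ^ m) ^ CARD('p) - 1 = (y ^ m - 1) * (y ^ m - 1) * r"
    using square_dvd_power_card_minus_1[of "y ^ m"] by (auto simp: power2_eq_square)
  have "(y - 1) * (\<Sum>i<m * CARD('p). y ^ i) = (y ^ m) ^ CARD('p) - 1"
    by (metis power_diff_1_eq power_mult)
  also have "\<dots> = (y - 1) * ((\<Sum>i<m. y ^ i) * (y ^ m - 1) * r)"
    unfolding r by (subst (1) power_diff_1_eq) (simp only: mult.assoc)
  finally have "(\<Sum>i<m * CARD('p). y ^ i) = (\<Sum>i<m. y ^ i) * (y ^ m - 1) * r"
    using assms by simp
  then show ?thesis by simp
qed

text \<open>In \<open>(x^m - 1) * a\<close> the terms at the exponents \<open>Max L + m\<close> and
  \<open>Min L\<close>, where \<open>L\<close> is the support of \<open>a\<close>, cannot cancel. So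
  a nonzero multiple of \<open>x^m - 1\<close> has exponents at least \<open>m\<close> apart, and
  the \<open>m\<close> chosen is one more than the spread of \<open>b\<close>.\<close>

lemma eq_0_if_all_x_pow_minus_1_dvd:
  fixes b :: "('p :: prime_card) laurent"
  assumes "\<And>m. m \<ge> 1 \<Longrightarrow> x_pow (int m) - 1 dvd b"
  shows "b = 0"
proof (rule ccontr)
  assume "b \<noteq> 0"
  define K where "K = Poly_Mapping.keys b"
  define m where "m = nat (Max K - Min K) + 1"
  obtain a where a: "b = (x_pow (int m) - 1) * a"
    using assms[of m] by (auto simp: m_def)
  have look: "Poly_Mapping.lookup b k = Poly_Mapping.lookup a (k - int m) - Poly_Mapping.lookup a k" for k
    by (simp add: a left_diff_distrib lookup_minus lookup_x_pow_mult)
  define L where "L = Poly_Mapping.keys a"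
  have "a \<noteq> 0" using a \<open>b \<noteq> 0\<close> by auto
  then have L: "finite L" "L \<noteq> {}" by (simp_all add: L_def)
  have "Max L \<in> L" "Min L \<in> L" using L by simp_all
  moreover have "Max L + int m \<notin> L" "Min L - int m \<notin> L"
    using Max_ge[OF L(1), of "Max L + int m"] Min_le[OF L(1), of "Min L - int m"]
    by (auto simp: m_def)
  ultimately have "Max L + int m \<in> K" "Min L \<in> K"
    by (simp_all add: look K_def L_def in_keys_iff)
  then have "Max L + int m \<le> Max K" "Min K \<le> Min L" by (simp_all add: K_def)
  moreover have "Min L \<le> Max L" using L by simp
  moreover have "Min K \<le> Max K" using \<open>b \<noteq> 0\<close> by (simp add: K_def)
  ultimately show False by (simp add: m_def)
qed

lemma finite_bounded_keys:
  assumes "finite K"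
  shows "finite {q :: 'a \<Rightarrow>\<^sub>0 'b :: {zero, finite}. Poly_Mapping.keys q \<subseteq> K}"
proof (rule inj_on_finite)
  show "inj_on (\<lambda>q. restrict (Poly_Mapping.lookup q) K) {q :: 'a \<Rightarrow>\<^sub>0 'b. Poly_Mapping.keys q \<subseteq> K}"
  proof (rule inj_onI, rule poly_mapping_eqI)
    fix q r :: "'a \<Rightarrow>\<^sub>0 'b" and k
    assume "q \<in> {q. Poly_Mapping.keys q \<subseteq> K}" "r \<in> {q. Poly_Mapping.keys q \<subseteq> K}"
      and eq: "restrict (Poly_Mapping.lookup q) K = restrict (Poly_Mapping.lookup r) K"
    then have "k \<notin> K \<Longrightarrow> Poly_Mapping.lookup q k = Poly_Mapping.lookup r k"
      by (metis in_keys_iff mem_Collect_eq subsetD)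
    moreover have "k \<in> K \<Longrightarrow> Poly_Mapping.lookup q k = Poly_Mapping.lookup r k"
      using fun_cong[OF eq, of k] by simp
    ultimately show "Poly_Mapping.lookup q k = Poly_Mapping.lookup r k" by blast
  qed
  show "finite (K \<rightarrow>\<^sub>E (UNIV :: 'b set))" using assms by (intro finite_PiE) auto
qed auto

text \<open>Modulo \<open>d\<close> all powers of \<open>x\<close> reduce to the finitely many Laurent polynomials of bounded
  degree, so two of them coincide.\<close>

lemma dvd_x_pow_minus_1:
  fixes d :: "('p :: prime_card) laurent"
  assumes "d \<noteq> 0"
  shows "\<exists>m\<ge>1. d dvd x_pow (int m) - 1"
proof -
  define K where "K = Poly_Mapping.keys d"
  have K: "finite K" "K \<noteq> {}" using assms by (simp_all add: K_def)
  \<comment> \<open>The extra 1 moves the exponents of \<open>d'\<close>, a monic unit multiple of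
    \<open>d\<close>, into the range from 1 to \<open>D\<close>. Thus \<open>D\<close> is positive
    even for a monomial \<open>d\<close>, and the polynomial 1 is already reduced when the induction
    starts.\<close>
  define a where "a = Min K - 1"
  define D where "D = Max K - a"
  define c where "c = Poly_Mapping.lookup d (Max K)"
  define d' where "d' = Poly_Mapping.single (- a) (inverse c) * d"
  have "Min K \<le> Max K" using K by simp
  then have "D \<ge> 1" by (simp add: D_def a_def)
  have "c \<noteq> 0" using Max_in[OF K] by (simp add: c_def K_def in_keys_iff)
  have look: "Poly_Mapping.lookup d' k = inverse c * Poly_Mapping.lookup d (k + a)" for k
    by (simp add: d'_def lookup_single_mult)
  have top: "Poly_Mapping.lookup d' D = 1"
    using \<open>c \<noteq> 0\<close> by (simp add: look D_def c_def)
  have out: "Poly_Mapping.lookup d' k = 0" if "k < 0 \<or> k > D" for k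
  proof -
    have "k + a \<notin> K"
      using that Max_ge[OF K(1), of "k + a"] Min_le[OF K(1), of "k + a"] by (auto simp: D_def a_def)
    then show ?thesis by (simp add: look K_def in_keys_iff)
  qed
  have "\<exists>q. Poly_Mapping.keys q \<subseteq> {0..<D} \<and> d dvd x_pow (int i) - q" for i
  proof (induction i)
    case 0
    then show ?case using \<open>D \<ge> 1\<close> by (intro exI[of _ 1]) (auto simp: x_pow_0)
  next
    case (Suc i)
    then obtain q where q: "Poly_Mapping.keys q \<subseteq> {0..<D}" "d dvd x_pow (int i) - q" by blast
    \<comment> \<open>Multiplication by \<open>x\<close> can overflow only at the exponent
      \<open>D\<close>; subtracting this multiple of the monic \<open>d'\<close> removes the
      overflow and keeps the class modulo \<open>d\<close>.\<close>
    define e where "e = Poly_Mapping.single 0 (Poly_Mapping.lookup q (D - 1)) * d'"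
    have q0: "Poly_Mapping.lookup q k = 0" if "k < 0 \<or> k \<ge> D" for k
      using q(1) that by (force simp: in_keys_iff)
    have "Poly_Mapping.lookup (x_pow 1 * q - e) k = 0" if "k < 0 \<or> k \<ge> D" for k
    proof (cases "k = D")
      case False
      then show ?thesis using that q0[of "k - 1"] out[of k]
        by (auto simp: e_def lookup_minus lookup_x_pow_mult lookup_single_mult)
    qed (simp add: e_def lookup_minus lookup_x_pow_mult lookup_single_mult top)
    then have "Poly_Mapping.keys (x_pow 1 * q - e) \<subseteq> {0..<D}"
      by (metis atLeastLessThan_iff in_keys_iff not_le subsetI)
    moreover have "x_pow (int (Suc i)) - (x_pow 1 * q - e) = x_pow 1 * (x_pow (int i) - q) + e"
      by (simp add: right_diff_distrib add.commute flip: x_pow_add)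
    moreover have "d dvd x_pow 1 * (x_pow (int i) - q) + e" using q(2) by (simp add: e_def d'_def)
    ultimately show ?case by metis
  qed
  then obtain q where q: "\<And>i. Poly_Mapping.keys (q i) \<subseteq> {0..<D}"
    "\<And>i. d dvd x_pow (int i) - q i" by metis
  have "finite (range q)"
    by (rule finite_subset[OF _ finite_bounded_keys[of "{0..<D}"]]) (use q(1) in auto)
  then have "\<not> inj q" using finite_imageD infinite_UNIV_nat by blast
  then obtain i j where ij: "i < j" "q i = q j"
    unfolding inj_def by (metis linorder_neqE_nat)
  have "d dvd (x_pow (int j) - q j) - (x_pow (int i) - q i)" by (intro dvd_diff q(2))
  then have "d dvd x_pow (- int i) * (x_pow (int j) - x_pow (int i))" using ij by simp
  also have "x_pow (- int i) * (x_pow (int j) - x_pow (int i)) = (x_pow (int (j - i)) - 1 :: 'p laurent)"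
    using ij by (simp add: right_diff_distrib of_nat_diff x_pow_0 flip: x_pow_add)
  finally show ?thesis using ij by (intro exI[of _ "j - i"]) simp
qed

subsection \<open>Separation in finitely generated modules\<close>

text \<open>The induction adds one generator \<open>g\<close> at a time, enlarging \<open>M\<close>, the span of \<open>U\<close> and the
  previous generators.  If no nonzero multiple of \<open>g\<close> lies in \<open>M\<close>, then comparing coefficients
  of \<open>g\<close> shows that the witnesses \<open>z\<close> lie in \<open>M\<close> already.  Otherwise some \<open>x^n - 1\<close> maps \<open>g\<close>
  into \<open>M\<close>, and one takes a witness for a multiple \<open>k\<close> of \<open>m\<close> and \<open>n\<close> such that \<open>x^k - 1\<close> is
  divisible by \<open>(x^m - 1) * (x^n - 1)\<close>.\<close>

lemma in_subspace_if_all_x_pow_minus_1: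
  fixes scale :: "('p :: prime_card) laurent \<Rightarrow> 'v :: ab_group_add \<Rightarrow> 'v"
  assumes "Modules.module scale" and U: "Modules.module.subspace scale U" and "finite G"
    and "\<And>m. m \<ge> 1 \<Longrightarrow>
      \<exists>z\<in>Modules.module.span scale (U \<union> G). w - scale (x_pow (int m) - 1) z \<in> U"
  shows "w \<in> U"
proof -
  interpret Modules.module scale by fact
  show ?thesis
    using assms(3,4)
  proof (induction G)
    case empty
    then obtain z where "z \<in> U" "w - scale (x_pow 1 - 1) z \<in> U"
      using U by (metis Un_empty_right le_refl of_nat_1 span_eq_iff)
    then show ?case using subspace_add[OF U] subspace_scale[OF U] by (metis diff_add_cancel)
  next
    case (insert g G)
    define M where "M = span (U \<union> G)"
    have M: "subspace M" "U \<subseteq> M" by (auto simp: M_def intro: span_base)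
    have M': "z \<in> span (U \<union> insert g G) \<longleftrightarrow> (\<exists>k. z - scale k g \<in> M)" for z
      by (simp add: M_def span_breakdown_eq)
    \<comment> \<open>Finding the witnesses in \<open>M\<close> removes \<open>g\<close> from the
      generators, after which the induction hypothesis for \<open>G\<close> applies.\<close>
    have "\<exists>z\<in>M. w - scale (x_pow (int m) - 1) z \<in> U" if "m \<ge> 1" for m
    proof (cases "\<exists>d. d \<noteq> 0 \<and> scale d g \<in> M")
      case True
      then obtain d where d: "d \<noteq> 0" "scale d g \<in> M" by blast
      obtain n where n: "n \<ge> 1" "d dvd x_pow (int n) - 1"
        using dvd_x_pow_minus_1[OF d(1)] by blast
      have "scale (x_pow (int n) - 1) g \<in> M"
        using n(2) subspace_scale[OF M(1) d(2)] by (metis dvdE mult.commute scale_scale)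
      have into: "scale (x_pow (int n) - 1) z \<in> M" if z: "z \<in> span (U \<union> insert g G)" for z
      proof -
        obtain k where "z - scale k g \<in> M" using z unfolding M' by blast
        then have "scale (x_pow (int n) - 1) (z - scale k g) + scale k (scale (x_pow (int n) - 1) g) \<in> M"
          using \<open>scale (x_pow (int n) - 1) g \<in> M\<close> M(1) subspace_add subspace_scale by metis
        then show ?thesis by (simp add: scale_right_diff_distrib mult.commute)
      qed
      \<comment> \<open>Both \<open>x^m - 1\<close> and \<open>x^n - 1\<close> divide
        \<open>y - 1\<close>, and \<open>(y - 1)^2\<close> divides \<open>y^p - 1\<close>. So the
        witness for \<open>k = p * n * m\<close> can be multiplied by the factor
        \<open>x^n - 1\<close>, which pushes it into \<open>M\<close>, while \<open>x^m - 1\<close>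
        remains outside.\<close>
      define y :: "'p laurent" where "y = x_pow (int n * int m)"
      obtain r where r: "y ^ CARD('p) - 1 = (y - 1) * (y - 1) * r"
        using square_dvd_power_card_minus_1[of y] by (auto simp: power2_eq_square)
      obtain a where a: "y - 1 = (x_pow (int m) - 1) * a"
        using x_pow_minus_1_dvd[of "int m" "int n * int m", where ?'p = 'p] by (auto simp: y_def)
      obtain b where b: "y - 1 = (x_pow (int n) - 1) * b"
        using x_pow_minus_1_dvd[of "int n" "int n * int m", where ?'p = 'p] by (auto simp: y_def)
      have "y ^ CARD('p) - 1 = ((x_pow (int m) - 1) * a) * ((x_pow (int n) - 1) * b) * r"
        using r a b by metis
      then have fact: "y ^ CARD('p) - 1 = (x_pow (int m) - 1) * ((a * b * r) * (x_pow (int n) - 1))"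
        by (simp add: algebra_simps)
      obtain z where z: "z \<in> span (U \<union> insert g G)" "w - scale (y ^ CARD('p) - 1) z \<in> U"
        using insert.prems[of "CARD('p) * (n * m)"] n(1) \<open>m \<ge> 1\<close>
        by (auto simp: y_def x_pow_power)
      have "w - scale (x_pow (int m) - 1) (scale (a * b * r) (scale (x_pow (int n) - 1) z)) \<in> U"
        using z(2) by (simp add: fact mult.assoc)
      moreover have "scale (a * b * r) (scale (x_pow (int n) - 1) z) \<in> M"
        by (rule subspace_scale[OF M(1) into[OF z(1)]])
      ultimately show ?thesis by blast
    next
      case False
      then have free: "k = 0" if "scale k g \<in> M" for k using that by blast
      have "\<exists>a z. w - scale (x_pow (int m) - 1) z \<in> U \<and> z - scale a g \<in> M" if "m \<ge> 1" for m
        using insert.prems[OF that] unfolding Bex_def M' by blast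
      then obtain a z where az: "\<And>m. m \<ge> 1 \<Longrightarrow> w - scale (x_pow (int m) - 1) (z m) \<in> U"
        "\<And>m. m \<ge> 1 \<Longrightarrow> z m - scale (a m) g \<in> M" by metis
      have coeff: "w - scale ((x_pow (int m) - 1) * a m) g \<in> M" if "m \<ge> 1" for m
      proof -
        have "(w - scale (x_pow (int m) - 1) (z m)) + scale (x_pow (int m) - 1) (z m - scale (a m) g) \<in> M"
          using az[OF that] M by (intro subspace_add subspace_scale) auto
        then show ?thesis by (simp add: scale_right_diff_distrib)
      qed
      have eq: "(x_pow (int m) - 1) * a m = (x_pow 1 - 1) * a 1" if "m \<ge> 1" for m
      proof -
        have "(w - scale ((x_pow (int 1) - 1) * a 1) g) - (w - scale ((x_pow (int m) - 1) * a m) g) \<in> M"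
          using subspace_diff[OF M(1) coeff[of 1] coeff[OF that]] by simp
        then have "scale ((x_pow (int m) - 1) * a m - (x_pow 1 - 1) * a 1) g \<in> M"
          by (simp add: scale_left_diff_distrib)
        then show ?thesis using free by fastforce
      qed
      \<comment> \<open>By \<open>eq\<close> this single element is divisible by every
        \<open>x^m - 1\<close>.\<close>
      then have "(x_pow 1 - 1) * a 1 = 0"
        by (intro eq_0_if_all_x_pow_minus_1_dvd) (metis dvd_triv_left)
      then have "a m = 0"
        using eq[OF \<open>m \<ge> 1\<close>] x_pow_minus_1_nonzero[of "int m", where ?'p = 'p] \<open>m \<ge> 1\<close>
        by (metis mult_eq_0_iff not_one_le_zero of_nat_eq_0_iff)
      then show ?thesis using az[OF \<open>m \<ge> 1\<close>] by auto
    qed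
    then show ?case using insert.IH by (simp add: M_def)
  qed
qed

section \<open>Restriction of scalars along the substitution of \<open>x^s\<close> for
  \<open>x\<close>\<close>

definition expand :: "int \<Rightarrow> ('p :: prime_card) laurent \<Rightarrow> 'p laurent" where
  "expand s r = (\<Sum>k\<in>Poly_Mapping.keys r. Poly_Mapping.single (s * k) (Poly_Mapping.lookup r k))"

lemma expand_superset:
  assumes "finite K" "Poly_Mapping.keys r \<subseteq> K"
  shows "expand s r = (\<Sum>k\<in>K. Poly_Mapping.single (s * k) (Poly_Mapping.lookup r k))"
  unfolding expand_def using assms
  by (intro sum.mono_neutral_left) (auto simp: in_keys_iff)

lemma expand_add: "expand s (q + r) = expand s q + expand s r"
proof -
  define K where "K = Poly_Mapping.keys q \<union> Poly_Mapping.keys r"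
  have "finite K" "Poly_Mapping.keys q \<subseteq> K" "Poly_Mapping.keys r \<subseteq> K" "Poly_Mapping.keys (q + r) \<subseteq> K"
    using keys_add[of q r] by (auto simp: K_def)
  then show ?thesis
    by (simp add: expand_superset lookup_add single_add sum.distrib)
qed

lemma expand_single: "expand s (Poly_Mapping.single k c) = Poly_Mapping.single (s * k) c"
  by (cases "c = 0") (simp_all add: expand_def)

lemma expand_1: "expand s 1 = 1"
  using expand_single[of s 0 1] by simp

lemma expand_mult: "expand s (q * r) = expand s q * expand s r"
proof (induction q rule: poly_mapping_single_induct)
  case (1 k c)
  show ?case
    by (induction r rule: poly_mapping_single_induct)
      (simp_all add: expand_single expand_add mult_single distrib_left)
qed (simp add: expand_add distrib_right)

lemma expand_x_pow_minus_1: "expand s (x_pow k - 1) = x_pow (s * k) - 1"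
proof -
  have "expand s (x_pow k - 1) + expand s 1 = x_pow (s * k)"
    by (simp add: x_pow_def expand_single flip: expand_add)
  then show ?thesis by (metis add_diff_cancel expand_1)
qed

text \<open>Letting \<open>r\<close> act through \<open>expand s r\<close> makes \<open>R^n\<close>
  a module over the Laurent polynomials in \<open>y = x^s\<close> without introducing a new ring:
  the scalar \<open>x^m - 1\<close> acts as \<open>y^m - 1\<close>.\<close>

lemma module_expand: "Modules.module (\<lambda>r (u :: ('p :: prime_card, 'n :: finite) lamps). expand s r *s u)"
proof unfold_locales
  fix r q :: "'p laurent" and u v :: "('p, 'n) lamps"
  show "expand s r *s (u + v) = expand s r *s u + expand s r *s v"
    by (simp add: vec_eq_iff distrib_left)
  show "expand s (r + q) *s u = expand s r *s u + expand s q *s u"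
    by (simp add: vec_eq_iff distrib_right expand_add)
  show "expand s r *s (expand s q *s u) = expand s (r * q) *s u"
    by (simp add: vec_eq_iff expand_mult mult.assoc)
  show "expand s 1 *s u = u"
    by (simp add: vec_eq_iff expand_1)
qed

text \<open>Every element of the prime field is the image of a natural number, so scaling by it is
  repeated addition.\<close>

lemma additive_subgroup_single_scale:
  fixes U :: "('p :: prime_card, 'n :: finite) lamps set"
  assumes "0 \<in> U" and add: "\<And>u v. u \<in> U \<Longrightarrow> v \<in> U \<Longrightarrow> u + v \<in> U" and "u \<in> U"
  shows "Poly_Mapping.single 0 c *s u \<in> U"
proof -
  have "of_nat n *s u \<in> U" for n
  proof (induction n)
    case (Suc n)
    have "of_nat (Suc n) *s u = u + of_nat n *s u"
      by (simp add: vec_eq_iff distrib_right)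
    then show ?case using add[OF \<open>u \<in> U\<close> Suc] by simp
  qed (use \<open>0 \<in> U\<close> in simp)
  then show ?thesis by (metis single_of_nat surj_of_nat_mod_ring)
qed

text \<open>Division with remainder of the exponents by \<open>s\<close> shows that
  \<open>x^0\<close>, ..., \<open>x^(s-1)\<close> generate \<open>R\<close> over the Laurent
  polynomials in \<open>x^s\<close>.\<close>

lemma span_expand_UNIV:
  fixes s :: nat
  assumes "s > 0"
  shows "Modules.module.span (\<lambda>r (u :: ('p :: prime_card, 'n :: finite) lamps). expand (int s) r *s u)
    ((\<lambda>(j, i). axis i (x_pow j)) ` ({0..<int s} \<times> UNIV)) = UNIV" (is "Modules.module.span _ ?B = _")
proof -
  interpret M: Modules.module "\<lambda>r (u :: ('p, 'n) lamps). expand (int s) r *s u"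
    by (rule module_expand)
  have axis: "axis i r \<in> M.span ?B" for i and r :: "'p laurent"
  proof (induction r rule: poly_mapping_single_induct)
    case (1 k c)
    have "axis i (x_pow (k mod int s)) \<in> M.span ?B"
      using assms by (intro M.span_base image_eqI[where x = "(k mod int s, i)"]) auto
    then have "expand (int s) (Poly_Mapping.single (k div int s) c) *s
        axis i (x_pow (k mod int s)) \<in> M.span ?B"
      by (rule M.span_scale)
    also have "expand (int s) (Poly_Mapping.single (k div int s) c) *s axis i (x_pow (k mod int s))
      = axis i (Poly_Mapping.single k c)"
      by (simp add: vec_eq_iff axis_def expand_single x_pow_def mult_single)
    finally show ?case .
  next
    case (2 q r)
    then have "axis i q + axis i r \<in> M.span ?B" by (rule M.span_add)
    moreover have "axis i q + axis i r = axis i (q + r)"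
      by (simp add: vec_eq_iff axis_def)
    ultimately show ?case by simp
  qed
  have "u \<in> M.span ?B" for u
  proof -
    have "(\<Sum>i\<in>UNIV. axis i (u $ i)) \<in> M.span ?B"
      using axis by (intro M.span_sum)
    moreover have "(\<Sum>i\<in>UNIV. axis i (u $ i)) = u"
      by (simp add: vec_eq_iff axis_def)
    ultimately show ?thesis by simp
  qed
  then show ?thesis by blast
qed

text \<open>Such a \<open>U\<close> is a submodule over the Laurent polynomials in
  \<open>x^s\<close>. If every \<open>m\<close> failed,
  \<open>in_subspace_if_all_x_pow_minus_1\<close> would put \<open>w\<close> into \<open>U\<close>;
  its generators are taken to span all of \<open>R^n\<close>, so that any \<open>z\<close> is an
  admissible witness.\<close>

lemma x_pow_stable_subgroup_separated:
  fixes U :: "('p :: prime_card, 'n :: finite) lamps set" and s :: nat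
  assumes "s > 0" "0 \<in> U" and add: "\<And>u v. u \<in> U \<Longrightarrow> v \<in> U \<Longrightarrow> u + v \<in> U"
    and stable: "\<And>u. u \<in> U \<Longrightarrow> x_pow (int s) *s u \<in> U" "\<And>u. u \<in> U \<Longrightarrow> x_pow (- int s) *s u \<in> U"
    and "w \<notin> U"
  shows "\<exists>m\<ge>1. \<forall>z. w - (x_pow (int s * int m) - 1) *s z \<notin> U"
proof (rule ccontr)
  assume "\<not> ?thesis"
  then have ex: "\<exists>z. w - (x_pow (int s * int m) - 1) *s z \<in> U" if "m \<ge> 1" for m
    using that by blast
  interpret M: Modules.module "\<lambda>r (u :: ('p, 'n) lamps). expand (int s) r *s u"
    by (rule module_expand)
  define B :: "('p, 'n) lamps set" where
    "B = (\<lambda>(j, i). axis i (x_pow j)) ` ({0..<int s} \<times> UNIV)"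
  have "finite B" by (simp add: B_def)
  have "M.span B = UNIV" unfolding B_def using \<open>s > 0\<close> by (rule span_expand_UNIV)
  then have span: "M.span (U \<union> B) = UNIV"
    using M.span_mono[of B "U \<union> B"] by auto
  have x_stable: "x_pow (int s * k) *s u \<in> U" if "u \<in> U" for k u
  proof (induction k rule: int_induct[where k = 0])
    case base
    then show ?case using that by (simp add: x_pow_0)
  next
    case (step1 i)
    have "x_pow (int s * (i + 1)) *s u = x_pow (int s) *s (x_pow (int s * i) *s u)"
      by (simp add: vec_eq_iff x_pow_add distrib_left mult.assoc mult.left_commute)
    then show ?case using stable(1)[OF step1(2)] by simp
  next
    case (step2 i)
    have "x_pow (int s * (i - 1)) *s u = x_pow (- int s) *s (x_pow (int s * i) *s u)"
      by (simp add: vector_smult_assoc right_diff_distrib flip: x_pow_add)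
    then show ?case using stable(2)[OF step2(2)] by simp
  qed
  have "expand (int s) r *s u \<in> U" if "u \<in> U" for r u
  proof (induction r rule: poly_mapping_single_induct)
    case (1 k c)
    have "Poly_Mapping.single 0 c *s (x_pow (int s * k) *s u) \<in> U"
      by (rule additive_subgroup_single_scale[OF \<open>0 \<in> U\<close> add x_stable[OF that]])
    then show ?case
      by (simp add: vector_smult_assoc expand_single flip: single_eq_scaled_x_pow)
  next
    case (2 q r)
    then show ?case using add by (simp add: expand_add M.scale_left_distrib[unfolded expand_add])
  qed
  then have "M.subspace U" using assms by (intro M.subspaceI) auto
  then have "w \<in> U"
  proof (rule in_subspace_if_all_x_pow_minus_1[OF M.module_axioms _ \<open>finite B\<close>])
    show "\<exists>z\<in>M.span (U \<union> B). w - expand (int s) (x_pow (int m) - 1) *s z \<in> U" if "m \<ge> 1" for m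
      using ex[OF that] by (simp add: span expand_x_pow_minus_1)
  qed
  then show False using \<open>w \<notin> U\<close> by contradiction
qed

subsection \<open>The completed group algebra\<close>

lemma x_pow_minus_1_dvd_x_pow_diff:
  assumes "m dvd j - k"
  shows "x_pow m - 1 dvd (x_pow j - x_pow k :: ('p :: prime_card) laurent)"
proof -
  have "x_pow j - x_pow k = x_pow k * (x_pow (j - k) - 1 :: 'p laurent)"
    by (simp add: right_diff_distrib flip: x_pow_add)
  then show ?thesis using x_pow_minus_1_dvd[OF assms] by (metis dvd_mult)
qed

lemma laurent_embed_superset:
  assumes "m \<ge> 1" "a \<in> {0..<int m}" "finite K" "Poly_Mapping.keys r \<subseteq> K"
  shows "laurent_embed r m a = (\<Sum>k\<in>{k \<in> K. k mod int m = a}. Poly_Mapping.lookup r k)"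
proof -
  have "laurent_embed r m a = (\<Sum>k\<in>{k \<in> Poly_Mapping.keys r. k mod int m = a}. Poly_Mapping.lookup r k)"
    using assms by (simp add: laurent_embed_def carrier_integer_mod_group)
  also have "\<dots> = (\<Sum>k\<in>{k \<in> K. k mod int m = a}. Poly_Mapping.lookup r k)"
    using assms by (intro sum.mono_neutral_left) (auto simp: in_keys_iff)
  finally show ?thesis .
qed

lemma laurent_embed_add:
  assumes "m \<ge> 1" "a \<in> {0..<int m}"
  shows "laurent_embed (q + r) m a = laurent_embed q m a + laurent_embed r m a"
proof -
  define K where "K = Poly_Mapping.keys q \<union> Poly_Mapping.keys r"
  have "finite K" "Poly_Mapping.keys q \<subseteq> K" "Poly_Mapping.keys r \<subseteq> K" "Poly_Mapping.keys (q + r) \<subseteq> K"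
    using keys_add[of q r] by (auto simp: K_def)
  then show ?thesis
    by (simp add: laurent_embed_superset[OF assms] lookup_add sum.distrib)
qed

lemma laurent_embed_single:
  assumes "m \<ge> 1" "a \<in> {0..<int m}"
  shows "laurent_embed (Poly_Mapping.single k c) m a = (if k mod int m = a then c else 0)"
proof -
  have "{j \<in> {k}. j mod int m = a} = (if k mod int m = a then {k} else {})" by auto
  then show ?thesis
    using laurent_embed_superset[OF assms, of "{k}" "Poly_Mapping.single k c"] by auto
qed

lemma laurent_embed_undefined:
  assumes "m \<ge> 1" "a \<notin> {0..<int m}"
  shows "laurent_embed r m a = undefined"
  using assms by (auto simp: laurent_embed_def carrier_integer_mod_group)

lemma laurent_embed_x_pow_mult:
  assumes "m \<ge> 1"
  shows "laurent_embed (x_pow (int m) * r) m = laurent_embed r m"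
proof
  fix a
  show "laurent_embed (x_pow (int m) * r) m a = laurent_embed r m a"
  proof (cases "a \<in> {0..<int m}")
    case True
    show ?thesis
      by (induction r rule: poly_mapping_single_induct)
        (simp_all add: x_pow_def mult_single laurent_embed_single[OF assms True] distrib_left
          laurent_embed_add[OF assms True])
  qed (simp add: laurent_embed_undefined[OF assms])
qed

text \<open>The sum is the representative of \<open>r\<close> with exponents in
  \<open>0..<m\<close>; for a monomial this is the congruence of \<open>x^k\<close> and
  \<open>x^(k mod m)\<close>.\<close>

lemma x_pow_minus_1_dvd_minus_reduced:
  assumes "m \<ge> 1"
  shows "x_pow (int m) - 1 dvd
    r - (\<Sum>a\<in>{0..<int m}. Poly_Mapping.single a (laurent_embed r m a))"
proof (induction r rule: poly_mapping_single_induct)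
  case (1 k c)
  have "(\<Sum>a\<in>{0..<int m}. Poly_Mapping.single a (laurent_embed (Poly_Mapping.single k c) m a))
      = (\<Sum>a\<in>{0..<int m}. if a = k mod int m then Poly_Mapping.single a c else 0)"
    by (rule sum.cong) (auto simp: laurent_embed_single[OF assms])
  also have "\<dots> = Poly_Mapping.single (k mod int m) c"
    using assms by simp
  finally have "Poly_Mapping.single k c -
      (\<Sum>a\<in>{0..<int m}. Poly_Mapping.single a (laurent_embed (Poly_Mapping.single k c) m a))
      = Poly_Mapping.single 0 c * (x_pow k - x_pow (k mod int m))"
    by (simp add: right_diff_distrib flip: single_eq_scaled_x_pow)
  moreover have "int m dvd k - k mod int m" by simp
  ultimately show ?case using x_pow_minus_1_dvd_x_pow_diff by (metis dvd_mult)
next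
  case (2 q r)
  have "(\<Sum>a\<in>{0..<int m}. Poly_Mapping.single a (laurent_embed (q + r) m a))
      = (\<Sum>a\<in>{0..<int m}. Poly_Mapping.single a (laurent_embed q m a))
        + (\<Sum>a\<in>{0..<int m}. Poly_Mapping.single a (laurent_embed r m a))"
    by (simp add: laurent_embed_add[OF assms] single_add sum.distrib)
  then show ?case using dvd_add[OF 2] by (simp add: algebra_simps)
qed

text \<open>The kernel of the reduction to the group algebra of the integers modulo \<open>m\<close>
  is the ideal of \<open>x^m - 1\<close>. This translates agreement at level \<open>m\<close> into
  divisibility.\<close>

lemma laurent_embed_eq_iff:
  assumes "m \<ge> 1"
  shows "laurent_embed q m = laurent_embed r m \<longleftrightarrow> x_pow (int m) - 1 dvd q - r"
proof
  assume "laurent_embed q m = laurent_embed r m"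
  then show "x_pow (int m) - 1 dvd q - r"
    using dvd_diff[OF x_pow_minus_1_dvd_minus_reduced[OF assms, of q]
        x_pow_minus_1_dvd_minus_reduced[OF assms, of r]] by simp
next
  assume "x_pow (int m) - 1 dvd q - r"
  then obtain z where z: "q - r = (x_pow (int m) - 1) * z" by blast
  \<comment> \<open>The relation is rearranged into sums, to which additivity of the embedding
    applies; the contributions of \<open>z\<close> then cancel.\<close>
  then have "q + z = r + x_pow (int m) * z"
    by (simp add: algebra_simps)
  then have eq: "laurent_embed (q + z) m = laurent_embed (r + x_pow (int m) * z) m" by simp
  show "laurent_embed q m = laurent_embed r m"
  proof
    fix a
    show "laurent_embed q m a = laurent_embed r m a"
    proof (cases "a \<in> {0..<int m}")
      case True
      then show ?thesis using fun_cong[OF eq, of a]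
        by (simp add: laurent_embed_add[OF assms True] laurent_embed_x_pow_mult[OF assms])
    qed (simp add: laurent_embed_undefined[OF assms])
  qed
qed

lemma finite_range_laurent_embed_component:
  assumes "m \<ge> 1"
  shows "finite (range (\<lambda>r :: ('p :: prime_card) laurent. laurent_embed r m))"
proof (rule finite_subset)
  show "range (\<lambda>r :: 'p laurent. laurent_embed r m) \<subseteq> {0..<int m} \<rightarrow>\<^sub>E UNIV"
    using assms by (auto simp: laurent_embed_undefined)
qed (simp add: finite_PiE)

section \<open>Neighbourhoods in the completed group algebra\<close>

lemma completed_algebra_eq_of_dvd:
  assumes "f \<in> completed_algebra" "g \<in> completed_algebra" "l \<ge> 1" "m \<ge> 1" "m dvd l" "f l = g l"
  shows "f m = g m"
  using assms unfolding completed_algebra_def by (metis (mono_tags, lifting) mem_Collect_eq)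

lemma topspace_completed_topology_power:
  "topspace completed_topology_power = (\<Pi>\<^sub>E i\<in>UNIV. completed_algebra)"
  by (simp add: completed_topology_power_def topspace_completed_topology)

lemma lamps_embed_in: "lamps_embed w \<in> topspace completed_topology_power"
  by (simp add: topspace_completed_topology_power lamps_embed_def laurent_embed_in PiE_iff)

lemma openin_completed_topology_component:
  assumes "m \<ge> 1"
  shows "openin completed_topology {f \<in> completed_algebra. f m \<in> S}"
proof -
  have "continuous_map completed_topology (discrete_topology (cyclic_algebra m)) (\<lambda>f. f m)"
    unfolding completed_topology_def
    using assms by (intro continuous_map_from_subtopology continuous_map_product_coordinates) simp
  then have "openin completed_topology
      {f \<in> topspace completed_topology. f m \<in> S \<inter> cyclic_algebra m}"
    by (rule openin_continuous_map_preimage) simp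
  moreover have "f m \<in> cyclic_algebra m" if "f \<in> completed_algebra" for f
    using that assms by (auto simp: completed_algebra_def PiE_iff)
  then have "{f \<in> topspace completed_topology. f m \<in> S \<inter> cyclic_algebra m}
      = {f \<in> completed_algebra. f m \<in> S}"
    by (auto simp: topspace_completed_topology)
  ultimately show ?thesis by simp
qed

text \<open>A basic open set restricts only finitely many levels. Their product is a common
  multiple, and by compatibility agreement at that one level forces agreement at all of
  them.\<close>

lemma openin_completed_topologyD:
  assumes "openin completed_topology O'" "f \<in> O'"
  shows "\<exists>m\<ge>1. \<forall>g\<in>completed_algebra. g m = f m \<longrightarrow> g \<in> O'"
proof -
  obtain T where T: "openin (product_topology (\<lambda>m. discrete_topology (cyclic_algebra m)) {1..}) T"
    "O' = T \<inter> completed_algebra"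
    using assms(1) by (auto simp: completed_topology_def openin_subtopology)
  then obtain X where X: "finite {k \<in> {1..}. X k \<noteq> topspace (discrete_topology (cyclic_algebra k))}"
    "f \<in> Pi\<^sub>E {1..} X" "Pi\<^sub>E {1..} X \<subseteq> T"
    using assms(2) unfolding openin_product_topology_alt by blast
  define K where "K = {k \<in> {1..}. X k \<noteq> cyclic_algebra k}"
  have K: "finite K" "\<And>k. k \<in> K \<Longrightarrow> k \<ge> 1" using X(1) by (auto simp: K_def)
  have "\<Prod>K \<ge> 1" using K(2) by (intro prod_ge_1)
  moreover have "g \<in> O'" if g: "g \<in> completed_algebra" "g (\<Prod>K) = f (\<Prod>K)" for g
  proof -
    have f: "f \<in> completed_algebra" using assms(2) T(2) by blast
    have "g k \<in> X k" if "k \<ge> 1" for k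
    proof (cases "k \<in> K")
      case True
      then have "k dvd \<Prod>K" using dvd_prodI[OF K(1), of k "\<lambda>k. k"] by simp
      then have "g k = f k"
        using completed_algebra_eq_of_dvd[OF g(1) f \<open>\<Prod>K \<ge> 1\<close> \<open>k \<ge> 1\<close>] g(2) by blast
      then show ?thesis using X(2) \<open>k \<ge> 1\<close> by (auto simp: PiE_iff)
    next
      case False
      then show ?thesis using g(1) \<open>k \<ge> 1\<close> by (auto simp: K_def completed_algebra_def PiE_iff)
    qed
    then have "g \<in> Pi\<^sub>E {1..} X" using g(1) by (auto simp: completed_algebra_def PiE_iff)
    then show ?thesis using X(3) T(2) g(1) by blast
  qed
  ultimately show ?thesis by blast
qed

text \<open>There are finitely many coordinates, so the product of their levels serves all of them
  at once.\<close>

lemma openin_completed_topology_powerD: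
  fixes f :: "'n :: finite \<Rightarrow> nat \<Rightarrow> int \<Rightarrow> ('p :: prime_card) mod_ring"
  assumes "openin completed_topology_power O'" "f \<in> O'"
  shows "\<exists>m\<ge>1. \<forall>g\<in>topspace completed_topology_power. (\<forall>i. g i m = f i m) \<longrightarrow> g \<in> O'"
proof -
  obtain X where X: "\<And>i. openin completed_topology (X i)" "f \<in> Pi\<^sub>E UNIV X" "Pi\<^sub>E UNIV X \<subseteq> O'"
    using bspec[OF iffD1[OF openin_product_topology_alt assms(1)[unfolded completed_topology_power_def]] assms(2)]
    by (auto intro: that)
  then have "\<exists>m\<ge>1. \<forall>g\<in>completed_algebra. g m = f i m \<longrightarrow> g \<in> X i" for i
    by (intro openin_completed_topologyD) auto
  then obtain m where m: "\<And>i. m i \<ge> 1"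
    "\<And>i g. g \<in> completed_algebra \<Longrightarrow> g (m i) = f i (m i) \<Longrightarrow> g \<in> X i" by metis
  define M where "M = (\<Prod>i\<in>UNIV. m i)"
  have "M \<ge> 1" unfolding M_def using m(1) by (intro prod_ge_1)
  have f: "f i \<in> completed_algebra" for i
    using assms openin_subset topspace_completed_topology_power by fastforce
  have "g \<in> O'" if g: "g \<in> topspace completed_topology_power" "\<forall>i. g i M = f i M" for g
  proof -
    have "g i \<in> X i" for i
    proof (rule m(2))
      show gi: "g i \<in> completed_algebra"
        using g(1) by (auto simp: topspace_completed_topology_power)
      have "m i dvd M" by (simp add: M_def dvd_prodI)
      then show "g i (m i) = f i (m i)"
        using completed_algebra_eq_of_dvd[OF gi f \<open>M \<ge> 1\<close> m(1)] g(2) by blast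
    qed
    then show ?thesis using X(3) by auto
  qed
  then show ?thesis using \<open>M \<ge> 1\<close> by blast
qed

text \<open>The sets of points agreeing with a given one at some level \<open>m\<close> form a
  neighbourhood base, and for embedded elements this agreement is congruence modulo
  \<open>x^m - 1\<close>.\<close>

lemma lamps_embed_in_closure_iff:
  fixes W :: "('p :: prime_card, 'n :: finite) lamps set"
  shows "lamps_embed w \<in> completed_topology_power closure_of (lamps_embed ` W) \<longleftrightarrow>
    (\<forall>m\<ge>1. \<exists>u\<in>W. \<forall>i. x_pow (int m) - 1 dvd u $ i - w $ i)"
proof (intro iffI allI impI)
  fix m :: nat
  assume clos: "lamps_embed w \<in> completed_topology_power closure_of (lamps_embed ` W)" and "m \<ge> 1"
  have "openin completed_topology_power
      (\<Pi>\<^sub>E i\<in>UNIV. {f \<in> completed_algebra. f m = lamps_embed w i m})"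
    unfolding completed_topology_power_def
    using openin_completed_topology_component[OF \<open>m \<ge> 1\<close>, of "{lamps_embed w _ m}"]
    by (simp add: openin_PiE_gen)
  moreover have "lamps_embed w \<in> (\<Pi>\<^sub>E i\<in>UNIV. {f \<in> completed_algebra. f m = lamps_embed w i m})"
    by (simp add: lamps_embed_def laurent_embed_in PiE_iff)
  ultimately obtain u where u: "u \<in> W"
    "lamps_embed u \<in> (\<Pi>\<^sub>E i\<in>UNIV. {f \<in> completed_algebra. f m = lamps_embed w i m})"
    using clos unfolding in_closure_of by blast
  have "laurent_embed (u $ i) m = laurent_embed (w $ i) m" for i
    using u(2) by (auto simp: lamps_embed_def PiE_iff)
  then show "\<exists>u\<in>W. \<forall>i. x_pow (int m) - 1 dvd u $ i - w $ i"
    using u(1) laurent_embed_eq_iff[OF \<open>m \<ge> 1\<close>] by blast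
next
  assume approx: "\<forall>m\<ge>1. \<exists>u\<in>W. \<forall>i. x_pow (int m) - 1 dvd u $ i - w $ i"
  show "lamps_embed w \<in> completed_topology_power closure_of (lamps_embed ` W)"
    unfolding in_closure_of
  proof (intro conjI allI impI lamps_embed_in)
    fix T assume T: "lamps_embed w \<in> T \<and> openin completed_topology_power T"
    then obtain m where m: "m \<ge> 1"
      "\<forall>g\<in>topspace completed_topology_power. (\<forall>i. g i m = lamps_embed w i m) \<longrightarrow> g \<in> T"
      using openin_completed_topology_powerD[OF conjunct2[OF T] conjunct1[OF T]] by metis
    then obtain u where u: "u \<in> W" "\<And>i. x_pow (int m) - 1 dvd u $ i - w $ i"
      using approx by blast
    then have "lamps_embed u \<in> T"
      by (intro m(2)[rule_format] lamps_embed_in)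
        (simp add: lamps_embed_def laurent_embed_eq_iff[OF m(1)])
    then show "\<exists>y. y \<in> lamps_embed ` W \<and> y \<in> T" using u(1) by blast
  qed
qed

lemma inj_lamps_embed: "inj lamps_embed"
proof (rule injI)
  fix u w :: "('p :: prime_card, 'n :: finite) lamps"
  assume "lamps_embed u = lamps_embed w"
  then have "laurent_embed (u $ i) = laurent_embed (w $ i)" for i
    unfolding lamps_embed_def by (rule fun_cong)
  then show "u = w" using inj_laurent_embed by (auto simp: vec_eq_iff dest: injD)
qed

lemma lamps_embed_closed_iff:
  fixes W :: "('p :: prime_card, 'n :: finite) lamps set"
  shows "lamps_embed ` W = (completed_topology_power closure_of (lamps_embed ` W)) \<inter> range lamps_embed \<longleftrightarrow>
    (\<forall>w. (\<forall>m\<ge>1. \<exists>u\<in>W. \<forall>i. x_pow (int m) - 1 dvd u $ i - w $ i) \<longrightarrow> w \<in> W)"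
proof -
  have "lamps_embed ` W \<subseteq> completed_topology_power closure_of (lamps_embed ` W)"
    using lamps_embed_in by (intro closure_of_subset) blast
  moreover have "lamps_embed w \<in> lamps_embed ` W \<longleftrightarrow> w \<in> W" for w
    by (rule inj_image_mem_iff[OF inj_lamps_embed])
  ultimately have "lamps_embed ` W = (completed_topology_power closure_of (lamps_embed ` W)) \<inter> range lamps_embed \<longleftrightarrow>
      (\<forall>w. lamps_embed w \<in> completed_topology_power closure_of (lamps_embed ` W) \<longrightarrow> w \<in> W)"
    by blast
  then show ?thesis by (simp only: lamps_embed_in_closure_iff)
qed

subsection \<open>Finite-index subgroups of the lamplighter group\<close>

lemma (in group) closedin_profinite_topology:
  "closedin (profinite_topology G) V \<longleftrightarrow> V \<subseteq> carrier G \<and>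
    (\<forall>g\<in>carrier G - V. \<exists>N. N \<lhd> G \<and> finite (rcosets N) \<and> (g <# N) \<inter> V = {})"
proof -
  \<comment> \<open>The group is a normal subgroup of index one in itself, hence open; this
    identifies the space underlying the topology.\<close>
  have "carrier G \<lhd> G" by (auto simp: normal_inv_iff subgroup_self)
  moreover have "rcosets (carrier G) \<subseteq> {carrier G}"
    by (auto simp: RCOSETS_def coset_join2[OF _ subgroup_self])
  then have "finite (rcosets (carrier G))" by (rule finite_subset) simp
  moreover have "g <# carrier G \<subseteq> carrier G" if "g \<in> carrier G" for g
    using that by (simp add: l_coset_subset_G)
  ultimately have "openin (profinite_topology G) (carrier G)"
    by (auto simp: openin_profinite_topology)
  then have top: "topspace (profinite_topology G) = carrier G"
    by (metis openin_profinite_topology openin_subset openin_topspace subset_antisym)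
  have "g <# N \<subseteq> carrier G - V \<longleftrightarrow> (g <# N) \<inter> V = {}" if "N \<lhd> G" "g \<in> carrier G" for g N
    using l_coset_subset_G[OF subgroup.subset[OF normal_imp_subgroup[OF that(1)]] that(2)] by blast
  then show ?thesis
    by (simp add: closedin_def top openin_profinite_topology Diff_subset) blast
qed

lemma finite_range_if_factors:
  assumes "finite (range f)" and "\<And>x y. f x = f y \<Longrightarrow> g x = g y"
  shows "finite (range g)"
proof (rule finite_surj[OF assms(1)])
  have "g x = g (inv_into UNIV f (f x))" for x
    by (rule assms(2)) (simp add: f_inv_into_f)
  then show "range g \<subseteq> (\<lambda>z. g (inv_into UNIV f z)) ` range f" by blast
qed

section \<open>Multiplication, inverses and powers in the lamplighter group\<close>

lemma carrier_lamplighter: "carrier lamplighter = UNIV"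
  by (simp add: lamplighter_def)

lemma mult_lamplighter: "(v, s) \<otimes>\<^bsub>lamplighter\<^esub> (w, t) = (v + x_pow s *s w, s + t)"
  by (simp add: lamplighter_def)

lemma one_lamplighter: "\<one>\<^bsub>lamplighter\<^esub> = (0, 0)"
  by (simp add: lamplighter_def)

lemma inv_lamplighter:
  "inv\<^bsub>lamplighter\<^esub> (v, s) = (- (x_pow (- s) *s v), - s)"
  by (rule group.inv_equality[OF group_lamplighter])
    (simp_all add: carrier_lamplighter mult_lamplighter one_lamplighter)

lemma pow_lamplighter:
  "(v, s) [^]\<^bsub>lamplighter\<^esub> (n :: nat) = ((\<Sum>i<n. x_pow s ^ i) *s v, int n * s)"
proof (induction n)
  case 0
  then show ?case by (simp add: one_lamplighter lamplighter_def)
next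
  case (Suc n)
  interpret group lamplighter by (rule group_lamplighter)
  show ?case
    using Suc by (simp add: mult_lamplighter x_pow_power vec_eq_iff algebra_simps)
qed

text \<open>Later applied to the intersection of \<open>V\<close> with a congruence subgroup, to
  cancel a second component without leaving either of the two.\<close>

lemma subgroup_lamplighter_multiples:
  assumes "subgroup K lamplighter" and "(c, b) \<in> K"
  shows "\<exists>d. (d, b * j) \<in> K"
proof (induction j rule: int_induct[where k = 0])
  case base
  then show ?case using subgroup.one_closed[OF assms(1)] by (auto simp: one_lamplighter)
next
  case (step1 i)
  then obtain d where "(d, b * i) \<in> K" by blast
  then have "(d, b * i) \<otimes>\<^bsub>lamplighter\<^esub> (c, b) \<in> K"
    using assms by (intro subgroup.m_closed)
  then show ?case by (auto simp: mult_lamplighter distrib_left)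
next
  case (step2 i)
  then obtain d where "(d, b * i) \<in> K" by blast
  then have "(d, b * i) \<otimes>\<^bsub>lamplighter\<^esub> inv\<^bsub>lamplighter\<^esub> (c, b) \<in> K"
    using assms by (intro subgroup.m_closed subgroup.m_inv_closed)
  then show ?case by (auto simp: mult_lamplighter inv_lamplighter right_diff_distrib)
qed

text \<open>For \<open>a\<close> dividing \<open>b\<close> this is the kernel of the reduction of
  the lamplighter group to the semidirect product of the \<open>n\<close>-th power of the group
  algebra of the integers modulo \<open>a\<close> with the integers modulo \<open>b\<close>.\<close>

definition congruence_subgroup ::
  "nat \<Rightarrow> nat \<Rightarrow> (('p :: prime_card, 'n :: finite) lamps \<times> int) set" where
  "congruence_subgroup a b = {(u, t). (\<forall>i. x_pow (int a) - 1 dvd u $ i) \<and> int b dvd t}"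

lemma x_pow_minus_1_dvd_mult:
  fixes r :: "('p :: prime_card) laurent"
  assumes "int a dvd t"
  shows "x_pow (int a) - 1 dvd x_pow t * r - r"
proof -
  have "x_pow t * r - r = (x_pow t - 1) * r" by (simp add: left_diff_distrib)
  then show ?thesis using x_pow_minus_1_dvd[OF assms] by (metis dvd_mult2)
qed

text \<open>Conjugating \<open>(u, t)\<close> by \<open>(v, s)\<close> gives the first component
  \<open>x^s u - (x^t - 1) v\<close>. As \<open>a\<close> divides \<open>b\<close> and
  \<open>b\<close> divides \<open>t\<close>, the second term is also a multiple of
  \<open>x^a - 1\<close>.\<close>

lemma normal_congruence_subgroup:
  assumes "a dvd b"
  shows "(congruence_subgroup a b :: (('p :: prime_card, 'n :: finite) lamps \<times> int) set) \<lhd> lamplighter"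
proof -
  interpret group "lamplighter :: (('p, 'n) lamps \<times> int) monoid" by (rule group_lamplighter)
  let ?N = "congruence_subgroup a b :: (('p, 'n) lamps \<times> int) set"
  have "subgroup ?N lamplighter"
  proof (rule subgroupI)
    have "(0, 0) \<in> ?N" by (simp add: congruence_subgroup_def)
    then show "?N \<noteq> {}" by blast
  qed (auto simp: congruence_subgroup_def carrier_lamplighter inv_lamplighter mult_lamplighter)
  moreover have "g \<otimes>\<^bsub>lamplighter\<^esub> h \<otimes>\<^bsub>lamplighter\<^esub> inv\<^bsub>lamplighter\<^esub> g \<in> ?N" if "h \<in> ?N" for g h
  proof -
    obtain v s u t where gh: "g = (v, s)" "h = (u, t)" by (metis surj_pair)
    have ut: "\<And>i. x_pow (int a) - 1 dvd u $ i" "int b dvd t"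
      using that by (auto simp: gh congruence_subgroup_def)
    have conj: "g \<otimes>\<^bsub>lamplighter\<^esub> h \<otimes>\<^bsub>lamplighter\<^esub> inv\<^bsub>lamplighter\<^esub> g = (v + x_pow s *s u - x_pow t *s v, t)"
      by (simp add: gh mult_lamplighter inv_lamplighter vector_smult_assoc flip: x_pow_add)
    have "int a dvd t" using ut(2) assms by (meson dvd_trans of_nat_dvd_iff)
    have "x_pow (int a) - 1 dvd x_pow s * u $ i - (x_pow t * v $ i - v $ i)" for i
      by (rule dvd_diff[OF dvd_mult[OF ut(1)] x_pow_minus_1_dvd_mult[OF \<open>int a dvd t\<close>]])
    moreover have "x_pow s * u $ i - (x_pow t * v $ i - v $ i) = (v + x_pow s *s u - x_pow t *s v) $ i" for i
      by simp
    ultimately show ?thesis using ut(2) by (simp only: conj congruence_subgroup_def) simp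
  qed
  ultimately show ?thesis by (simp add: normal_inv_iff)
qed

text \<open>The coset of \<open>(u, t)\<close> is determined by the reduction of \<open>u\<close> at
  level \<open>a\<close> and by \<open>t mod b\<close>, which take finitely many values.\<close>

lemma finite_rcosets_congruence_subgroup:
  assumes "a dvd b" "b \<ge> 1"
  shows "finite (rcosets\<^bsub>lamplighter\<^esub>
    (congruence_subgroup a b :: (('p :: prime_card, 'n :: finite) lamps \<times> int) set))"
proof -
  interpret group "lamplighter :: (('p, 'n) lamps \<times> int) monoid" by (rule group_lamplighter)
  let ?N = "congruence_subgroup a b :: (('p, 'n) lamps \<times> int) set"
  have "a \<ge> 1" using assms by (cases a) auto
  define f :: "('p, 'n) lamps \<times> int \<Rightarrow> ('n \<Rightarrow> int \<Rightarrow> 'p mod_ring) \<times> int" where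
    "f = (\<lambda>(u, t). (\<lambda>i. laurent_embed (u $ i) a, t mod int b))"
  have "range f \<subseteq> (UNIV \<rightarrow>\<^sub>E range (\<lambda>r. laurent_embed r a)) \<times> {0..<int b}"
    using assms(2) by (auto simp: f_def)
  then have "finite (range f)"
    by (rule finite_subset)
      (intro finite_cartesian_product finite_PiE finite_range_laurent_embed_component \<open>a \<ge> 1\<close>; simp)
  moreover have "?N #>\<^bsub>lamplighter\<^esub> g = ?N #>\<^bsub>lamplighter\<^esub> h" if eq: "f g = f h" for g h
  proof -
    obtain v s w t where gh: "g = (v, s)" "h = (w, t)" by (metis surj_pair)
    have "(\<lambda>i. laurent_embed (v $ i) a) = (\<lambda>i. laurent_embed (w $ i) a)"
      using eq by (simp add: f_def gh)
    then have "laurent_embed (w $ i) a = laurent_embed (v $ i) a" for i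
      by (metis fun_cong)
    then have emb: "x_pow (int a) - 1 dvd w $ i - v $ i" for i
      using laurent_embed_eq_iff[OF \<open>a \<ge> 1\<close>] by blast
    have "s mod int b = t mod int b" using eq by (simp add: f_def gh)
    then have b: "int b dvd t - s" by (metis mod_eq_dvd_iff)
    then have a: "int a dvd t - s" using assms(1) by (meson dvd_trans of_nat_dvd_iff)
    have "x_pow (int a) - 1 dvd (w $ i - v $ i) - (x_pow (t - s) * v $ i - v $ i)" for i
      by (rule dvd_diff[OF emb x_pow_minus_1_dvd_mult[OF a]])
    moreover have "(w $ i - v $ i) - (x_pow (t - s) * v $ i - v $ i) = (w - x_pow (t - s) *s v) $ i" for i
      by simp
    ultimately have "(w - x_pow (t - s) *s v, t - s) \<in> ?N"
      using b by (simp only: congruence_subgroup_def) simp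
    moreover have "h = (w - x_pow (t - s) *s v, t - s) \<otimes>\<^bsub>lamplighter\<^esub> g"
      by (simp add: gh mult_lamplighter)
    ultimately have "h \<in> ?N #>\<^bsub>lamplighter\<^esub> g" by (auto simp: r_coset_def)
    then show ?thesis
      using normal_imp_subgroup[OF normal_congruence_subgroup[OF assms(1)]]
      by (intro repr_independence) (simp_all add: carrier_lamplighter)
  qed
  ultimately have "finite (range (\<lambda>g. ?N #>\<^bsub>lamplighter\<^esub> g))"
    by (rule finite_range_if_factors)
  then show ?thesis
    by (simp add: RCOSETS_def carrier_lamplighter full_SetCompr_eq UNION_singleton_eq_range)
qed

lemma finite_index_contains_multiples:
  fixes N :: "(('p :: prime_card, 'n :: finite) lamps \<times> int) set"
  assumes N: "N \<lhd> lamplighter" and fin: "finite (rcosets\<^bsub>lamplighter\<^esub> N)"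
  shows "\<exists>m\<ge>1. \<forall>u. (\<forall>i. x_pow (int m) - 1 dvd u $ i) \<longrightarrow> (u, 0) \<in> N"
proof -
  interpret group "lamplighter :: (('p, 'n) lamps \<times> int) monoid" by (rule group_lamplighter)
  have sub: "subgroup N lamplighter" using N by (rule normal_imp_subgroup)
  \<comment> \<open>Finitely many cosets force some \<open>(0, i)\<close> and \<open>(0, j)\<close>
    with \<open>i < j\<close> into the same one, and then their quotient \<open>(0, j - i)\<close>
    lies in \<open>N\<close>.\<close>
  define c where "c = (\<lambda>i :: nat. N #>\<^bsub>lamplighter\<^esub> (0, int i))"
  have "range c \<subseteq> rcosets\<^bsub>lamplighter\<^esub> N"
    by (auto simp: c_def RCOSETS_def carrier_lamplighter)
  then have "finite (range c)" using fin by (rule finite_subset)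
  then have "\<not> inj c" using finite_imageD infinite_UNIV_nat by blast
  then obtain i j where ij: "i < j" "c i = c j"
    unfolding inj_def by (metis linorder_neqE_nat)
  have "(0, int j) \<in> c i"
    unfolding ij(2) unfolding c_def by (rule rcos_self[OF _ sub]) (simp add: carrier_lamplighter)
  then obtain u t where "(u, t) \<in> N" "(0, int j) = (u, t) \<otimes>\<^bsub>lamplighter\<^esub> (0, int i)"
    by (auto simp: c_def r_coset_def)
  then have "u = 0" "t = int (j - i)"
    using ij(1) by (simp_all add: mult_lamplighter of_nat_diff)
  define m where "m = j - i"
  have m: "m \<ge> 1" "(0, int m) \<in> N"
    using ij(1) \<open>(u, t) \<in> N\<close> \<open>u = 0\<close> \<open>t = int (j - i)\<close> by (simp_all add: m_def)
  have "(u, 0) \<in> N" if "\<forall>i. x_pow (int m) - 1 dvd u $ i" for u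
  proof -
    have "\<forall>i. \<exists>z. u $ i = (x_pow (int m) - 1) * z" using that by (auto simp: dvd_def)
    then obtain z where z: "\<And>i. u $ i = (x_pow (int m) - 1) * z i" by metis
    \<comment> \<open>With this sign the commutator of \<open>g\<close> and \<open>(0, m)\<close> is
      exactly \<open>(u, 0)\<close>.\<close>
    define g :: "('p, 'n) lamps \<times> int" where "g = (- (\<chi> i. z i), 0)"
    have "g \<otimes>\<^bsub>lamplighter\<^esub> (0, int m) \<otimes>\<^bsub>lamplighter\<^esub> inv\<^bsub>lamplighter\<^esub> g \<in> N"
      using N m(2) unfolding normal_inv_iff carrier_lamplighter by blast
    then have "g \<otimes>\<^bsub>lamplighter\<^esub> (0, int m) \<otimes>\<^bsub>lamplighter\<^esub> inv\<^bsub>lamplighter\<^esub> g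
        \<otimes>\<^bsub>lamplighter\<^esub> inv\<^bsub>lamplighter\<^esub> (0, int m) \<in> N"
      by (rule subgroup.m_closed[OF sub _ subgroup.m_inv_closed[OF sub m(2)]])
    moreover have "g \<otimes>\<^bsub>lamplighter\<^esub> (0, int m) \<otimes>\<^bsub>lamplighter\<^esub> inv\<^bsub>lamplighter\<^esub> g
        \<otimes>\<^bsub>lamplighter\<^esub> inv\<^bsub>lamplighter\<^esub> (0, int m) = (u, 0)"
      by (simp add: g_def mult_lamplighter inv_lamplighter x_pow_0 vec_eq_iff z left_diff_distrib)
    ultimately show ?thesis by simp
  qed
  then show ?thesis using m(1) by blast
qed

subsection \<open>Closed subgroups\<close>

lemma closedin_lamplighter_iff:
  "closedin (profinite_topology lamplighter) (V :: (('p :: prime_card, 'n :: finite) lamps \<times> int) set) \<longleftrightarrow>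
    (\<forall>g. g \<notin> V \<longrightarrow> (\<exists>N. N \<lhd> lamplighter \<and> finite (rcosets\<^bsub>lamplighter\<^esub> N) \<and>
      (\<forall>h\<in>N. g \<otimes>\<^bsub>lamplighter\<^esub> h \<notin> V)))"
proof -
  have "(g <#\<^bsub>lamplighter\<^esub> N) \<inter> V = {} \<longleftrightarrow> (\<forall>h\<in>N. g \<otimes>\<^bsub>lamplighter\<^esub> h \<notin> V)" for g N
    unfolding l_coset_def by blast
  then show ?thesis
    by (simp add: group.closedin_profinite_topology[OF group_lamplighter] carrier_lamplighter Ball_def)
qed

lemma closedin_if_congruence_separated:
  fixes V :: "(('p :: prime_card, 'n :: finite) lamps \<times> int) set"
  assumes "\<And>w t. (w, t) \<notin> V \<Longrightarrow> \<exists>a b. a dvd b \<and> b \<ge> 1 \<and>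
    (\<forall>(u, r)\<in>congruence_subgroup a b. (w, t) \<otimes>\<^bsub>lamplighter\<^esub> (u, r) \<notin> V)"
  shows "closedin (profinite_topology lamplighter) V"
  unfolding closedin_lamplighter_iff
proof (intro allI impI)
  fix g assume "g \<notin> V"
  then obtain a b where ab: "a dvd b" "b \<ge> 1"
    "\<forall>h\<in>congruence_subgroup a b. g \<otimes>\<^bsub>lamplighter\<^esub> h \<notin> V"
    using assms[of "fst g" "snd g"] by auto
  then show "\<exists>N. N \<lhd> lamplighter \<and> finite (rcosets\<^bsub>lamplighter\<^esub> N) \<and>
      (\<forall>h\<in>N. g \<otimes>\<^bsub>lamplighter\<^esub> h \<notin> V)"
    using normal_congruence_subgroup finite_rcosets_congruence_subgroup by blast
qed

lemma closedin_if_trivial_projection: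
  fixes V0 :: "('p :: prime_card, 'n :: finite) lamps set"
  assumes "\<And>w. (\<forall>m\<ge>1. \<exists>u\<in>V0. \<forall>i. x_pow (int m) - 1 dvd u $ i - w $ i) \<Longrightarrow> w \<in> V0"
  shows "closedin (profinite_topology lamplighter) (base_incl ` V0)"
proof (rule closedin_if_congruence_separated)
  fix w :: "('p, 'n) lamps" and t :: int
  assume wt: "(w, t) \<notin> base_incl ` V0"
  \<comment> \<open>For nonzero \<open>t\<close>, a modulus exceeding its absolute value cannot
    divide it, so no product lands in the base group. For \<open>t = 0\<close> the name is rebound
    to a level at which \<open>w\<close> is not approximated by \<open>V0\<close>.\<close>
  define m where "m = nat \<bar>t\<bar> + 1"
  show "\<exists>a b. a dvd b \<and> b \<ge> 1 \<and>
    (\<forall>(u, r)\<in>congruence_subgroup a b. (w, t) \<otimes>\<^bsub>lamplighter\<^esub> (u, r) \<notin> base_incl ` V0)"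
  proof (cases "t = 0")
    case True
    then have "w \<notin> V0" using wt by (auto simp: base_incl_def)
    then have "\<not> (\<forall>m\<ge>1. \<exists>u\<in>V0. \<forall>i. x_pow (int m) - 1 dvd u $ i - w $ i)"
      using assms[of w] by (rule contrapos_nn)
    then obtain m where m: "m \<ge> 1" "\<not> (\<exists>u\<in>V0. \<forall>i. x_pow (int m) - 1 dvd u $ i - w $ i)"
      unfolding not_all not_imp by (elim exE conjE) (rule that)
    have "(w, t) \<otimes>\<^bsub>lamplighter\<^esub> (u, r) \<notin> base_incl ` V0" if "(u, r) \<in> congruence_subgroup m m" for u r
    proof
      assume "(w, t) \<otimes>\<^bsub>lamplighter\<^esub> (u, r) \<in> base_incl ` V0"
      then have "w + u \<in> V0" by (auto simp: True mult_lamplighter base_incl_def x_pow_0)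
      moreover have "x_pow (int m) - 1 dvd (w + u) $ i - w $ i" for i
        using that by (simp add: congruence_subgroup_def)
      ultimately show False using m(2) by blast
    qed
    then show ?thesis using m(1) by (intro exI[of _ m]) auto
  next
    case False
    have "(w, t) \<otimes>\<^bsub>lamplighter\<^esub> (u, r) \<notin> base_incl ` V0" if "(u, r) \<in> congruence_subgroup m m" for u r
    proof
      assume "(w, t) \<otimes>\<^bsub>lamplighter\<^esub> (u, r) \<in> base_incl ` V0"
      then have "t = - r" by (auto simp: mult_lamplighter base_incl_def)
      then have "int m dvd t" using that by (simp add: congruence_subgroup_def)
      then show False using dvd_imp_le_int[OF False, of "int m"] by (simp add: m_def)
    qed
    then show ?thesis by (intro exI[of _ m]) (auto simp: m_def)
  qed
qed

text \<open>A coset of \<open>(w, 0)\<close> missing the subgroup would still contain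
  \<open>(u, 0)\<close> for every \<open>u\<close> close enough to \<open>w\<close>, because
  finite-index normal subgroups contain all base elements divisible by some
  \<open>x^m - 1\<close>.\<close>

lemma approximable_in_closed_subgroup:
  fixes V0 :: "('p :: prime_card, 'n :: finite) lamps set"
  assumes "closedin (profinite_topology lamplighter) (base_incl ` V0)"
    and "\<And>m. m \<ge> 1 \<Longrightarrow> \<exists>u\<in>V0. \<forall>i. x_pow (int m) - 1 dvd u $ i - w $ i"
  shows "w \<in> V0"
proof (rule ccontr)
  assume "w \<notin> V0"
  then have "(w, 0) \<notin> base_incl ` V0" by (auto simp: base_incl_def)
  then obtain N where N: "N \<lhd> lamplighter" "finite (rcosets\<^bsub>lamplighter\<^esub> N)"
    "\<And>h. h \<in> N \<Longrightarrow> (w, 0) \<otimes>\<^bsub>lamplighter\<^esub> h \<notin> base_incl ` V0"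
    using assms(1) unfolding closedin_lamplighter_iff by meson
  obtain m where m: "m \<ge> 1" "\<And>u. (\<forall>i. x_pow (int m) - 1 dvd u $ i) \<Longrightarrow> (u, 0) \<in> N"
    using finite_index_contains_multiples[OF N(1,2)] by blast
  obtain u where u: "u \<in> V0" "\<forall>i. x_pow (int m) - 1 dvd u $ i - w $ i"
    using assms(2)[OF m(1)] by blast
  then have "(u - w, 0) \<in> N" by (intro m(2)) simp
  then have "(w, 0) \<otimes>\<^bsub>lamplighter\<^esub> (u - w, 0) \<notin> base_incl ` V0" by (rule N(3))
  then show False using u(1) by (simp add: mult_lamplighter x_pow_0 base_incl_def)
qed

lemma closedin_if_nontrivial_projection:
  fixes V :: "(('p :: prime_card, 'n :: finite) lamps \<times> int) set" and s :: nat
  assumes V: "subgroup V lamplighter" and proj: "snd ` V = range (\<lambda>k. int s * k)" and "s > 0"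
  shows "closedin (profinite_topology lamplighter) V"
proof (rule closedin_if_congruence_separated)
  interpret group "lamplighter :: (('p, 'n) lamps \<times> int) monoid" by (rule group_lamplighter)
  note V_mult = subgroup.m_closed[OF V] and V_inv = subgroup.m_inv_closed[OF V]
  fix w :: "('p, 'n) lamps" and t :: int
  assume wt: "(w, t) \<notin> V"
  show "\<exists>a b. a dvd b \<and> b \<ge> 1 \<and>
    (\<forall>(u, r)\<in>congruence_subgroup a b. (w, t) \<otimes>\<^bsub>lamplighter\<^esub> (u, r) \<notin> V)"
  proof (cases "int s dvd t")
    case False
    \<comment> \<open>Here the projection to the integers modulo \<open>s\<close> already separates
      \<open>(w, t)\<close> from \<open>V\<close>.\<close>
    have "(w, t) \<otimes>\<^bsub>lamplighter\<^esub> (u, r) \<notin> V" if "(u, r) \<in> congruence_subgroup s s" for u r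
    proof
      assume "(w, t) \<otimes>\<^bsub>lamplighter\<^esub> (u, r) \<in> V"
      then have "t + r \<in> snd ` V" by (force simp: mult_lamplighter)
      then have "int s dvd t + r" by (auto simp: proj)
      moreover have "int s dvd r" using that by (simp add: congruence_subgroup_def)
      ultimately show False using False by (simp add: dvd_add_left_iff)
    qed
    then show ?thesis using \<open>s > 0\<close> by (intro exI[of _ s]) auto
  next
    case True
    then have "t \<in> snd ` V" by (auto simp: proj)
    then obtain c where c: "(c, t) \<in> V" by auto
    have "int s \<in> snd ` V" unfolding proj by (rule image_eqI[of _ _ 1]) auto
    then obtain v where v: "(v, int s) \<in> V" by auto
    define U where "U = {u. (u, 0) \<in> V}"
    \<comment> \<open>The base component of \<open>(c, t)^(-1) (w, t)\<close>. Since
      \<open>(c, t)\<close> lies in \<open>V\<close>, the question becomes one about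
      \<open>w'\<close> and \<open>U\<close>.\<close>
    define w' where "w' = x_pow (- t) *s (w - c)"
    have w': "(w, t) = (c, t) \<otimes>\<^bsub>lamplighter\<^esub> (w', 0)"
      by (simp add: mult_lamplighter w'_def vector_smult_assoc x_pow_0 flip: x_pow_add)
    have "w' \<notin> U"
      using wt V_mult[OF c] unfolding U_def w' by blast
    moreover have "0 \<in> U"
      using subgroup.one_closed[OF V] by (simp add: U_def one_lamplighter)
    moreover have "u + u' \<in> U" if "u \<in> U" "u' \<in> U" for u u'
      using V_mult[of "(u, 0)" "(u', 0)"] that by (simp add: U_def mult_lamplighter x_pow_0)
    moreover have "x_pow (int s) *s u \<in> U" if "u \<in> U" for u
    proof -
      \<comment> \<open>Conjugation by \<open>(v, s)\<close> acts on the base group as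
        multiplication by \<open>x^s\<close>.\<close>
      have "(v, int s) \<otimes>\<^bsub>lamplighter\<^esub> (u, 0) \<otimes>\<^bsub>lamplighter\<^esub> inv\<^bsub>lamplighter\<^esub> (v, int s) \<in> V"
        using that v by (intro V_mult V_inv) (simp_all add: U_def)
      then show ?thesis
        by (simp add: U_def mult_lamplighter inv_lamplighter vector_smult_assoc x_pow_0 flip: x_pow_add)
    qed
    moreover have "x_pow (- int s) *s u \<in> U" if "u \<in> U" for u
    proof -
      have "inv\<^bsub>lamplighter\<^esub> (v, int s) \<otimes>\<^bsub>lamplighter\<^esub> (u, 0) \<otimes>\<^bsub>lamplighter\<^esub> (v, int s) \<in> V"
        using that v by (intro V_mult V_inv) (simp_all add: U_def)
      then show ?thesis
        by (simp add: U_def mult_lamplighter inv_lamplighter)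
    qed
    ultimately obtain m where m: "m \<ge> 1"
      "\<And>z. w' - (x_pow (int s * int m) - 1) *s z \<notin> U"
      using x_pow_stable_subgroup_separated[of s U w'] \<open>s > 0\<close> by blast
    \<comment> \<open>The modulus \<open>s * m\<close> is the one separating \<open>w'\<close> from
      \<open>U\<close>. The factor \<open>p\<close> in the second argument ensures that the power
      \<open>h\<close> of \<open>(v, s)\<close> lies in \<open>N\<close>.\<close>
    define N :: "(('p, 'n) lamps \<times> int) set" where
      "N = congruence_subgroup (s * m) (s * m * CARD('p))"
    have "subgroup N lamplighter"
      unfolding N_def by (intro normal_imp_subgroup normal_congruence_subgroup) simp
    then have VN: "subgroup (V \<inter> N) lamplighter" by (rule subgroups_Inter_pair[OF V])
    define h where "h = (v, int s) [^]\<^bsub>lamplighter\<^esub> (m * CARD('p))"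
    have h: "h = ((\<Sum>i<m * CARD('p). x_pow (int s) ^ i) *s v, int (s * m * CARD('p)))"
      by (simp add: h_def pow_lamplighter)
    have "x_pow (int s) \<noteq> (1 :: 'p laurent)"
      using x_pow_minus_1_nonzero[of "int s", where ?'p = 'p] \<open>s > 0\<close> by auto
    then have "x_pow (int (s * m)) - 1 dvd (\<Sum>i<m * CARD('p). x_pow (int s) ^ i :: 'p laurent)"
      using power_minus_1_dvd_sum_powers[of "x_pow (int s) :: 'p laurent" m]
      by (simp add: x_pow_power mult.commute)
    then have "h \<in> N" unfolding h N_def congruence_subgroup_def by simp
    moreover have "(v, int s) [^]\<^bsub>lamplighter\<^esub> (n :: nat) \<in> V" for n
      by (induction n) (simp_all add: subgroup.one_closed[OF V] V_mult v)
    then have "h \<in> V" by (simp only: h_def)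
    ultimately have "h \<in> V \<inter> N" by simp
    have "(w, t) \<otimes>\<^bsub>lamplighter\<^esub> (u, r) \<notin> V" if ur: "(u, r) \<in> N" for u r
    proof
      assume "(w, t) \<otimes>\<^bsub>lamplighter\<^esub> (u, r) \<in> V"
      then have "inv\<^bsub>lamplighter\<^esub> (c, t) \<otimes>\<^bsub>lamplighter\<^esub> ((w, t) \<otimes>\<^bsub>lamplighter\<^esub> (u, r)) \<in> V"
        by (rule V_mult[OF V_inv[OF c]])
      then have V1: "(w', 0) \<otimes>\<^bsub>lamplighter\<^esub> (u, r) \<in> V"
        by (simp add: w' m_assoc[symmetric] carrier_lamplighter)
      obtain j where "r = int (s * m * CARD('p)) * j"
        using ur by (auto simp: N_def congruence_subgroup_def)
      \<comment> \<open>An element of \<open>V\<close> and \<open>N\<close> over \<open>-r\<close>.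
        Multiplying by it returns to the base group inside \<open>V\<close> and alters
        \<open>w'\<close> only by a multiple of \<open>x^(s m) - 1\<close>, against the choice of
        \<open>m\<close>.\<close>
      then obtain d where d: "(d, - r) \<in> V \<inter> N"
        using subgroup_lamplighter_multiples[OF VN \<open>h \<in> V \<inter> N\<close>[unfolded h], of "- j"] by auto
      have "(u, r) \<otimes>\<^bsub>lamplighter\<^esub> (d, - r) \<in> N"
        using ur d by (intro subgroup.m_closed[OF \<open>subgroup N lamplighter\<close>]) simp_all
      then have "\<forall>i. x_pow (int (s * m)) - 1 dvd (u + x_pow r *s d) $ i"
        by (simp add: mult_lamplighter N_def congruence_subgroup_def)
      then obtain z where z: "\<And>i. (u + x_pow r *s d) $ i = (x_pow (int (s * m)) - 1) * z i"
        unfolding dvd_def by metis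
      have "(w', 0) \<otimes>\<^bsub>lamplighter\<^esub> (u, r) \<otimes>\<^bsub>lamplighter\<^esub> (d, - r) \<in> V"
        using d by (intro V_mult[OF V1]) simp
      then have "w' + (u + x_pow r *s d) \<in> U"
        by (simp add: U_def mult_lamplighter x_pow_0 add.assoc)
      also have "w' + (u + x_pow r *s d) = w' - (x_pow (int s * int m) - 1) *s (- (\<chi> i. z i))"
        using z by (simp add: vec_eq_iff left_diff_distrib)
      finally show False using m(2) by contradiction
    qed
    then show ?thesis
      using \<open>s > 0\<close> m(1) by (intro exI[of _ "s * m"] exI[of _ "s * m * CARD('p)"]) (auto simp: N_def)
  qed
qed

theorem theorem3p25:
  fixes V :: "(('p :: prime_card, 'n :: finite) lamps \<times> int) set"
    and s :: nat and V0 :: "('p, 'n) lamps set" and v :: "('p, 'n) lamps"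
  assumes "subgroup V lamplighter"
    and "is_triple V s V0 v"
  shows "closedin (profinite_topology lamplighter) V \<longleftrightarrow>
    s > 0 \<or>
    (s = 0 \<and> V = base_incl ` V0 \<and>
      lamps_embed ` V0 =
        (completed_topology_power closure_of (lamps_embed ` V0)) \<inter> range lamps_embed)"
proof (cases "s > 0")
  case True
  then show ?thesis
    using closedin_if_nontrivial_projection assms by (auto simp: is_triple_def)
next
  case False
  then have s: "s = 0" by simp
  then have proj: "snd ` V = {0}" and V0: "V0 = {w. base_incl w \<in> V}"
    using assms(2) by (auto simp: is_triple_def)
  have "t = 0" if "(w, t) \<in> V" for w t using imageI[OF that, of snd] proj by simp
  then have V: "V = base_incl ` V0"
    by (auto simp: V0 base_incl_def image_iff)
  \<comment> \<open>Closedness is expressed by the same congruences modulo \<open>x^m - 1\<close>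
    that describe the closure in the completed algebra.\<close>
  have "closedin (profinite_topology lamplighter) (base_incl ` V0) \<longleftrightarrow>
      (\<forall>w. (\<forall>m\<ge>1. \<exists>u\<in>V0. \<forall>i. x_pow (int m) - 1 dvd u $ i - w $ i) \<longrightarrow> w \<in> V0)"
  proof (intro iffI allI impI)
    fix w
    assume "closedin (profinite_topology lamplighter) (base_incl ` V0)"
      and "\<forall>m\<ge>1. \<exists>u\<in>V0. \<forall>i. x_pow (int m) - 1 dvd u $ i - w $ i"
    then show "w \<in> V0" by (intro approximable_in_closed_subgroup) simp_all
  qed (rule closedin_if_trivial_projection; blast)
  then have "closedin (profinite_topology lamplighter) V \<longleftrightarrow>
      lamps_embed ` V0 = (completed_topology_power closure_of (lamps_embed ` V0)) \<inter> range lamps_embed"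
    unfolding V lamps_embed_closed_iff .
  then show ?thesis using s V by blast
qed

end
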